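(* Let $m,n\ge 0$ be integers with $m+n\ge 1$, let $r\ge 1$, and let $V=\bigoplus_{k=1}^{m+n}\mathbb{Q}(q)v_k$ be the $\mathbb{Z}_2$-graded vector space with $|v_k|=0$ for $k\le m$ and $|v_k|=1$ for $k>m$. Let $\pi_r$ be the sign $q$-permutation representation of the Iwahori-Hecke algebra $\mathcal{H}_{\mathbb{Q}(q),r}(q)$ on $V^{\otimes r}$ (acting on the right), and let $\rho_r$ be the representation of $U_q^\sigma(\mathfrak{gl}(m,n))$ on $V^{\otimes r}$ (acting on the left) obtained from the vector representation. Then for every $g\in\mathcal{H}_{\mathbb{Q}(q),r}(q)$ and every $x\in U_q^\sigma(\mathfrak{gl}(m,n))$, $$\pi_r(g)\rho_r(x)=\rho_r(x)\pi_r(g)$$ as operators on $V^{\otimes r}$.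
   Context: Here $q$ is an indeterminate and tensor products are over $\mathbb{Q}(q)$. **Hecke algebra and $\pi_r$.** $\mathcal{H}_{\mathbb{Q}(q),r}(q)$ is the unital associative $\mathbb{Q}(q)$-algebra generated by $T_1,\dots,T_{r-1}$ with relations $T_i^2=(q-q^{-1})T_i+1$; $T_iT_{i+1}T_i=T_{i+1}T_iT_{i+1}$; $T_iT_j=T_jT_i$ for $|i-j|>1$. Let $T$ be the right operator on $V\otimes V$ given by $$(v_k\otimes v_l)T=\begin{cases}\dfrac{(-1)^{|v_k|}(q+q^{-1})+q-q^{-1}}{2}\,v_k\otimes v_l & \text{if } k=l,\\ (-1)^{|v_k||v_l|}v_l\otimes v_k+(q-q^{-1})v_k\otimes v_l & \text{if } k<l,\\ (-1)^{|v_k||v_l|}v_l\otimes v_k & \text{if } k>l.\end{cases}$$ The sign $q$-permutation representation $\pi_r$ is the right representation with $\pi_r(T_i)=\operatorname{Id}^{\otimes (i-1)}\otimes T\otimes \operatorname{Id}^{\otimes (r-i-1)}$. **Root data.** $I=\{1,\dots,m+n-1\}$; $p(i)=1$ if $i=m$ and $p(i)=0$ if $i\ne m$. $P=\bigoplus_{b=1}^{m+n}\mathbb{Z}\epsilon_b$ with symmetric bilinear form $(\epsilon_a,\epsilon_{a'})=0$ for $a\neq a'$, $(\epsilon_a,\epsilon_a)=1$ for $a\le m$, $(\epsilon_a,\epsilon_a)=-1$ for $a>m$. $P^*=\operatorname{Hom}_{\mathbb{Z}}(P,\mathbb{Z})$, with natural pairing $\langle h,\lambda\rangle$, also written $\lambda(h)$.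 $\alpha_i=\epsilon_i-\epsilon_{i+1}$ for $i\in I$; $\ell_i=1$ for $i\le m$ and $\ell_i=-1$ for $i>m$; $h_i\in P^*$ is determined by $\ell_i\langle h_i,\lambda\rangle=(\alpha_i,\lambda)$ for all $\lambda\in P$. **Quantum superalgebra.** $U_q(\mathfrak{gl}(m,n))$ is the unital associative $\mathbb{Q}(q)$-algebra generated by $q^h$ ($h\in P^*$), $e_i,f_i$ ($i\in I$) with: $q^0=1$; $q^{h}q^{h'}=q^{h+h'}$; $q^he_i=q^{\langle h,\alpha_i\rangle}e_iq^h$; $q^hf_i=q^{-\langle h,\alpha_i\rangle}f_iq^h$; $e_if_j-(-1)^{p(i)p(j)}f_je_i=\delta_{ij}\frac{q^{\ell_ih_i}-q^{-\ell_ih_i}}{q^{\ell_i}-q^{-\ell_i}}$; and with the following further conditions imposed, where $U_q(\mathfrak n_+)$ (resp. $U_q(\mathfrak n_-)$) is the subalgebra generated by the $e_i$ (resp. $f_i$): if $a\in\sum_iU_q(\mathfrak n_+)e_iU_q(\mathfrak n_+)$ satisfies $f_ia\in U_q(\mathfrak n_+)f_i$ for all $i\in I$, then $a=0$; if $a\in\sum_iU_q(\mathfrak n_-)f_iU_q(\mathfrak n_-)$ satisfies $e_ia\in U_q(\mathfrak n_-)e_i$ for all $i\in I$, then $a=0$. Let $\sigma$ be the involutive automorphism of $U_q(\mathfrak{gl}(m,n))$ with $\sigma(q^h)=q^h$, $\sigma(e_i)=(-1)^{p(i)}e_i$, $\sigma(f_i)=(-1)^{p(i)}f_i$. Then $U_q^\sigma(\mathfrak{gl}(m,n))=U_q(\mathfrak{gl}(m,n))\oplus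 U_q(\mathfrak{gl}(m,n))\sigma$ is the algebra with the additional multiplication law $\sigma^2=1$, $\sigma^{-1}x\sigma=\sigma(x)$. It is a Hopf algebra with comultiplication $\triangle_\sigma(\sigma)=\sigma\otimes\sigma$, $\triangle_\sigma(q^h)=q^h\otimes q^h$, $\triangle_\sigma(e_i)=e_i\otimes q^{-\ell_ih_i}+\sigma^{p(i)}\otimes e_i$, $\triangle_\sigma(f_i)=f_i\otimes 1+\sigma^{p(i)}q^{\ell_ih_i}\otimes f_i$. **Vector representation.** $\rho$ is the (known to be well-defined) representation of $U_q^\sigma(\mathfrak{gl}(m,n))$ on $V$ given by $\rho(\sigma)v_j=(-1)^{|v_j|}v_j$; $\rho(q^h)v_j=q^{\epsilon_j(h)}v_j$; $\rho(e_j)v_{j+1}=v_j$ and $\rho(e_j)v_k=0$ for $k\neq j+1$; $\rho(f_j)v_j=v_{j+1}$ and $\rho(f_j)v_k=0$ for $k\ne j$. The representation $\rho_r$ on $V^{\otimes r}$ is obtained from $\rho$ by iterating $\triangle_\sigma$; explicitly $\rho_r(\sigma)=\rho(\sigma)^{\otimes r}$, $\rho_r(q^h)=\rho(q^h)^{\otimes r}$, $\rho_r(e_i)=\sum_{k=1}^r\rho(\sigma^{p(i)})^{\otimes (k-1)}\otimes\rho(e_i)\otimes\rho(q^{-\ell_ih_i})^{\otimes (r-k)}$, $\rho_r(f_i)=\sum_{k=1}^r\rho(\sigma^{p(i)}q^{\ell_ih_i})^{\otimes (k-1)}\otimes\rho(f_i)\otimes\operatorname{Id}^{\otimes (r-k)}$.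 *)

theory Defs
  imports
    "HOL-Computational_Algebra.Polynomial"
    "HOL-Computational_Algebra.Fraction_Field"
    "HOL-Library.Poly_Mapping"
    "HOL-Library.Function_Algebras"
    "HOL-Algebra.QuotRing"
begin

section \<open>The ground field and presented algebras\<close>

type_synonym ratfun = "rat poly fract"

definition q :: ratfun where
  "q = Fract [:0, 1:] 1"

datatype 'g fword = Word (letters: "'g list")

instantiation fword :: (type) monoid_add
begin
definition zero_fword :: "'a fword" where "zero_fword = Word []"
definition plus_fword :: "'a fword \<Rightarrow> 'a fword \<Rightarrow> 'a fword" where
  "plus_fword u v = Word (letters u @ letters v)"
instance
  by standard (simp_all add: zero_fword_def plus_fword_def)
end

text \<open>Since the sum of words is concatenation, the convolution product of finitely supported
  functions on words is the product of the free associative unital algebra.\<close>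

type_synonym 'g free = "'g fword \<Rightarrow>\<^sub>0 ratfun"

definition gen :: "'g \<Rightarrow> 'g free" where
  "gen g = Poly_Mapping.single (Word [g]) 1"

definition const :: "ratfun \<Rightarrow> 'g free" where
  "const c = Poly_Mapping.single (Word []) c"

definition free_alg :: "'g set \<Rightarrow> 'g free ring" where
  "free_alg G = \<lparr>carrier = {a. \<forall>w\<in>Poly_Mapping.keys a. set (letters w) \<subseteq> G},
     mult = (*), one = 1, zero = 0, add = (+)\<rparr>"

inductive_set subalg :: "'g free set \<Rightarrow> 'g free set" for S :: "'g free set" where
  subalg_const: "const c \<in> subalg S"
| subalg_gen: "a \<in> S \<Longrightarrow> a \<in> subalg S"
| subalg_add: "a \<in> subalg S \<Longrightarrow> b \<in> subalg S \<Longrightarrow> a + b \<in> subalg S"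
| subalg_mult: "a \<in> subalg S \<Longrightarrow> b \<in> subalg S \<Longrightarrow> a * b \<in> subalg S"

text \<open>\<open>sum_ideal A X\<close> is the sum of all \<open>A x A\<close> with \<open>x \<in> X\<close>.\<close>

inductive_set sum_ideal :: "'g free set \<Rightarrow> 'g free set \<Rightarrow> 'g free set"
  for A X :: "'g free set" where
  sum_ideal_zero: "0 \<in> sum_ideal A X"
| sum_ideal_prod: "a \<in> A \<Longrightarrow> x \<in> X \<Longrightarrow> b \<in> A \<Longrightarrow> a * x * b \<in> sum_ideal A X"
| sum_ideal_add: "u \<in> sum_ideal A X \<Longrightarrow> v \<in> sum_ideal A X \<Longrightarrow> u + v \<in> sum_ideal A X"

text \<open>A \<open>ratfun\<close>-algebra is a ring together with the map sending a scalar \<open>c\<close> to \<open>c\<close> times the unit.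
  A unital ring homomorphism is linear iff it is compatible with these maps.\<close>

definition alg_hom ::
  "'a ring \<Rightarrow> (ratfun \<Rightarrow> 'a) \<Rightarrow> 'b ring \<Rightarrow> (ratfun \<Rightarrow> 'b) \<Rightarrow> ('a \<Rightarrow> 'b) \<Rightarrow> bool" where
  "alg_hom A \<iota>A B \<iota>B \<phi> \<longleftrightarrow> \<phi> \<in> ring_hom A B \<and> (\<forall>c. \<phi> (\<iota>A c) = \<iota>B c)"

definition opposite :: "'a ring \<Rightarrow> 'a ring" where
  "opposite R = R\<lparr>mult := (\<lambda>x y. y \<otimes>\<^bsub>R\<^esub> x)\<rparr>"

section \<open>Tensor powers of V and their endomorphisms\<close>

text \<open>The \<open>r\<close>-th tensor power of the space with basis \<open>v\<^sub>1, \<dots>, v\<^sub>N\<close> has as basis the pure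
  tensors of basis vectors, indexed by the words of length \<open>r\<close> in \<open>{1..N}\<close>. A tensor is the
  function giving its coordinates; \<open>V\<close> itself is the case \<open>r = 1\<close>.\<close>

type_synonym vec = "nat list \<Rightarrow> ratfun"

definition words :: "nat \<Rightarrow> nat \<Rightarrow> nat list set" where
  "words N r = {w. length w = r \<and> set w \<subseteq> {1..N}}"

definition tensor_space :: "nat \<Rightarrow> nat \<Rightarrow> vec set" where
  "tensor_space N r = {f. \<forall>w. w \<notin> words N r \<longrightarrow> f w = 0}"

definition basis :: "nat list \<Rightarrow> vec" where
  "basis w = (\<lambda>u. if u = w then 1 else 0)"

definition scale :: "ratfun \<Rightarrow> vec \<Rightarrow> vec" where
  "scale c f = (\<lambda>u. c * f u)"

text \<open>Operators are extended by \<open>0\<close> outside \<open>tensor_space N r\<close>, so that equality of operators is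
  equality of functions.\<close>

definition lin_ext :: "nat \<Rightarrow> nat \<Rightarrow> (nat list \<Rightarrow> vec) \<Rightarrow> vec \<Rightarrow> vec" where
  "lin_ext N r \<phi> = (\<lambda>f. if f \<in> tensor_space N r then \<Sum>w\<in>words N r. scale (f w) (\<phi> w) else 0)"

definition scalar_op :: "nat \<Rightarrow> nat \<Rightarrow> ratfun \<Rightarrow> vec \<Rightarrow> vec" where
  "scalar_op N r c = (\<lambda>f. if f \<in> tensor_space N r then scale c f else 0)"

abbreviation id_op :: "nat \<Rightarrow> nat \<Rightarrow> vec \<Rightarrow> vec" where
  "id_op N r \<equiv> scalar_op N r 1"

definition End_alg :: "nat \<Rightarrow> nat \<Rightarrow> (vec \<Rightarrow> vec) ring" where
  "End_alg N r = \<lparr>carrier = {A.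
       (\<forall>f\<in>tensor_space N r. A f \<in> tensor_space N r) \<and>
       (\<forall>f\<in>tensor_space N r. \<forall>g\<in>tensor_space N r. A (f + g) = A f + A g) \<and>
       (\<forall>c. \<forall>f\<in>tensor_space N r. A (scale c f) = scale c (A f)) \<and>
       (\<forall>f. f \<notin> tensor_space N r \<longrightarrow> A f = 0)},
     mult = (\<circ>), one = id_op N r, zero = 0, add = (+)\<rparr>"

definition vec_tensor :: "nat \<Rightarrow> vec \<Rightarrow> vec \<Rightarrow> vec" where
  "vec_tensor k x y = (\<lambda>u. x (take k u) * y (drop k u))"

text \<open>\<open>op_tensor N k A l B\<close> is the tensor product of operators \<open>A\<close> on the \<open>k\<close>-th and \<open>B\<close> on the
  \<open>l\<close>-th tensor power, without Koszul signs.\<close>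

definition op_tensor ::
  "nat \<Rightarrow> nat \<Rightarrow> (vec \<Rightarrow> vec) \<Rightarrow> nat \<Rightarrow> (vec \<Rightarrow> vec) \<Rightarrow> vec \<Rightarrow> vec" where
  "op_tensor N k A l B =
     lin_ext N (k + l) (\<lambda>w. vec_tensor k (A (basis (take k w))) (B (basis (drop k w))))"

fun tensor_ops :: "nat \<Rightarrow> (vec \<Rightarrow> vec) list \<Rightarrow> vec \<Rightarrow> vec" where
  "tensor_ops N [] = id_op N 0"
| "tensor_ops N (A # As) = op_tensor N 1 A (length As) (tensor_ops N As)"

section \<open>The Hecke algebra and the sign q-permutation representation\<close>

definition hecke_rels :: "nat \<Rightarrow> nat free set" where
  "hecke_rels r =
     {gen i * gen i - (const (q - inverse q) * gen i + 1) | i. i \<in> {1..<r}} \<union>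
     {gen i * gen (i + 1) * gen i - gen (i + 1) * gen i * gen (i + 1) | i.
        i \<in> {1..<r} \<and> i + 1 \<in> {1..<r}} \<union>
     {gen i * gen j - gen j * gen i | i j.
        i \<in> {1..<r} \<and> j \<in> {1..<r} \<and> (i + 1 < j \<or> j + 1 < i)}"

definition hecke_class :: "nat \<Rightarrow> nat free \<Rightarrow> nat free set" where
  "hecke_class r a = (Idl\<^bsub>free_alg {1..<r}\<^esub> (hecke_rels r)) +>\<^bsub>free_alg {1..<r}\<^esub> a"

definition hecke :: "nat \<Rightarrow> nat free set ring" where
  "hecke r = free_alg {1..<r} Quot (Idl\<^bsub>free_alg {1..<r}\<^esub> (hecke_rels r))"

definition v_par :: "nat \<Rightarrow> nat \<Rightarrow> nat" where
  "v_par m k = (if k \<le> m then 0 else 1)"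

definition T_op :: "nat \<Rightarrow> nat \<Rightarrow> vec \<Rightarrow> vec" where
  "T_op m n = lin_ext (m + n) 2 (\<lambda>w. let k = w ! 0; l = w ! 1 in
     if k = l then
       scale (((-1) ^ v_par m k * (q + inverse q) + q - inverse q) / 2) (basis [k, l])
     else if k < l then
       scale ((-1) ^ (v_par m k * v_par m l)) (basis [l, k]) + scale (q - inverse q) (basis [k, l])
     else
       scale ((-1) ^ (v_par m k * v_par m l)) (basis [l, k]))"

text \<open>A right representation is a homomorphism to the opposite of the endomorphism algebra, whose
  elements are still written as functions applied on the left.\<close>

definition sign_q_perm_rep ::
  "nat \<Rightarrow> nat \<Rightarrow> nat \<Rightarrow> (nat free set \<Rightarrow> vec \<Rightarrow> vec) \<Rightarrow> bool" where
  "sign_q_perm_rep m n r \<pi> \<longleftrightarrow>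
     alg_hom (hecke r) (\<lambda>c. hecke_class r (const c))
       (opposite (End_alg (m + n) r)) (scalar_op (m + n) r) \<pi> \<and>
     (\<forall>i\<in>{1..<r}. \<pi> (hecke_class r (gen i)) =
        op_tensor (m + n) (i - 1) (id_op (m + n) (i - 1)) (2 + (r - i - 1))
          (op_tensor (m + n) 2 (T_op m n) (r - i - 1) (id_op (m + n) (r - i - 1))))"

section \<open>Root data\<close>

type_synonym weight = "nat \<Rightarrow> int"
type_synonym coweight = "weight \<Rightarrow> int"

definition I_set :: "nat \<Rightarrow> nat \<Rightarrow> nat set" where
  "I_set m n = {1..<m + n}"

definition par :: "nat \<Rightarrow> nat \<Rightarrow> nat" where
  "par m i = (if i = m then 1 else 0)"

definition P_lattice :: "nat \<Rightarrow> nat \<Rightarrow> weight set" where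
  "P_lattice m n = {x. \<forall>b. b \<notin> {1..m + n} \<longrightarrow> x b = 0}"

definition P_dual :: "nat \<Rightarrow> nat \<Rightarrow> coweight set" where
  "P_dual m n = {h. (\<forall>x\<in>P_lattice m n. \<forall>y\<in>P_lattice m n. h (x + y) = h x + h y) \<and>
     (\<forall>x. x \<notin> P_lattice m n \<longrightarrow> h x = 0)}"

definition eps :: "nat \<Rightarrow> weight" where
  "eps b = (\<lambda>a. if a = b then 1 else 0)"

definition bform :: "nat \<Rightarrow> nat \<Rightarrow> weight \<Rightarrow> weight \<Rightarrow> int" where
  "bform m n x y = (\<Sum>b = 1..m + n. (if b \<le> m then 1 else -1) * x b * y b)"

definition root :: "nat \<Rightarrow> weight" where
  "root i = eps i - eps (i + 1)"

definition ell :: "nat \<Rightarrow> nat \<Rightarrow> int" where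
  "ell m i = (if i \<le> m then 1 else -1)"

text \<open>As \<open>ell m i\<close> is its own inverse, this is the solution of
  \<open>ell m i * h x = bform m n (root i) x\<close> for all \<open>x\<close> in the lattice.\<close>

definition coroot :: "nat \<Rightarrow> nat \<Rightarrow> nat \<Rightarrow> coweight" where
  "coroot m n i = (\<lambda>x. if x \<in> P_lattice m n then ell m i * bform m n (root i) x else 0)"

definition ell_coroot :: "nat \<Rightarrow> nat \<Rightarrow> nat \<Rightarrow> coweight" where
  "ell_coroot m n i = (\<lambda>x. ell m i * coroot m n i x)"

section \<open>The quantum superalgebra\<close>

datatype ugen = QH coweight | E nat | F nat

definition u_gens :: "nat \<Rightarrow> nat \<Rightarrow> ugen set" where
  "u_gens m n = QH ` P_dual m n \<union> E ` I_set m n \<union> F ` I_set m n"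

definition u_rels :: "nat \<Rightarrow> nat \<Rightarrow> ugen free set" where
  "u_rels m n =
     {gen (QH 0) - 1} \<union>
     {gen (QH h) * gen (QH h') - gen (QH (h + h')) | h h'. h \<in> P_dual m n \<and> h' \<in> P_dual m n} \<union>
     {gen (QH h) * gen (E i) - const (q powi (h (root i))) * gen (E i) * gen (QH h) | h i.
        h \<in> P_dual m n \<and> i \<in> I_set m n} \<union>
     {gen (QH h) * gen (F i) - const (q powi (- h (root i))) * gen (F i) * gen (QH h) | h i.
        h \<in> P_dual m n \<and> i \<in> I_set m n} \<union>
     {gen (E i) * gen (F j) - const ((-1) ^ (par m i * par m j)) * gen (F j) * gen (E i) -
        (if i = j then const (inverse (q powi ell m i - q powi (- ell m i))) *
           (gen (QH (ell_coroot m n i)) - gen (QH (- ell_coroot m n i))) else 0) | i j.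
        i \<in> I_set m n \<and> j \<in> I_set m n}"

definition u_pos :: "nat \<Rightarrow> nat \<Rightarrow> ugen free set" where
  "u_pos m n = subalg ((\<lambda>i. gen (E i)) ` I_set m n)"

definition u_neg :: "nat \<Rightarrow> nat \<Rightarrow> ugen free set" where
  "u_neg m n = subalg ((\<lambda>i. gen (F i)) ` I_set m n)"

text \<open>The two further conditions, read modulo the ideal \<open>J\<close>: the subalgebras generated by the
  \<open>e\<^sub>i\<close> and by the \<open>f\<^sub>i\<close> in the quotient by \<open>J\<close> are the images of \<open>u_pos\<close> and \<open>u_neg\<close>.\<close>

definition further_conditions :: "nat \<Rightarrow> nat \<Rightarrow> ugen free set \<Rightarrow> bool" where
  "further_conditions m n J \<longleftrightarrow>
     (\<forall>a\<in>sum_ideal (u_pos m n) ((\<lambda>i. gen (E i)) ` I_set m n).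
        (\<forall>i\<in>I_set m n. \<exists>b\<in>u_pos m n. gen (F i) * a - b * gen (F i) \<in> J) \<longrightarrow> a \<in> J) \<and>
     (\<forall>a\<in>sum_ideal (u_neg m n) ((\<lambda>i. gen (F i)) ` I_set m n).
        (\<forall>i\<in>I_set m n. \<exists>b\<in>u_neg m n. gen (E i) * a - b * gen (E i) \<in> J) \<longrightarrow> a \<in> J)"

text \<open>Ideals with \<open>further_conditions\<close> are closed under intersection, so there is a smallest one
  containing the relations.\<close>

definition u_ideal :: "nat \<Rightarrow> nat \<Rightarrow> ugen free set" where
  "u_ideal m n = \<Inter>{J. ideal J (free_alg (u_gens m n)) \<and> u_rels m n \<subseteq> J \<and> further_conditions m n J}"

definition U :: "nat \<Rightarrow> nat \<Rightarrow> ugen free set ring" where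
  "U m n = free_alg (u_gens m n) Quot u_ideal m n"

definition u_class :: "nat \<Rightarrow> nat \<Rightarrow> ugen free \<Rightarrow> ugen free set" where
  "u_class m n a = u_ideal m n +>\<^bsub>free_alg (u_gens m n)\<^esub> a"

section \<open>The extension by the parity automorphism\<close>

fun ugen_par :: "nat \<Rightarrow> ugen \<Rightarrow> nat" where
  "ugen_par m (QH h) = 0"
| "ugen_par m (E i) = par m i"
| "ugen_par m (F i) = par m i"

definition free_sigma :: "nat \<Rightarrow> ugen free \<Rightarrow> ugen free" where
  "free_sigma m a = (\<Sum>w\<in>Poly_Mapping.keys a. Poly_Mapping.single w
     ((-1) ^ sum_list (map (ugen_par m) (letters w)) * Poly_Mapping.lookup a w))"

text \<open>\<open>free_sigma\<close> preserves \<open>u_ideal\<close>, so the image of the coset of \<open>a\<close> is the coset of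
  \<open>free_sigma m a\<close>.\<close>

definition sigma :: "nat \<Rightarrow> ugen free set \<Rightarrow> ugen free set" where
  "sigma m X = free_sigma m ` X"

text \<open>The pair \<open>(a, b)\<close> stands for \<open>a + b\<sigma>\<close>; the product uses \<open>\<sigma> y = \<sigma>(y) \<sigma>\<close>.\<close>

definition U_sigma :: "nat \<Rightarrow> nat \<Rightarrow> (ugen free set \<times> ugen free set) ring" where
  "U_sigma m n = \<lparr>carrier = carrier (U m n) \<times> carrier (U m n),
     mult = (\<lambda>(a, b) (c, d).
       ((a \<otimes>\<^bsub>U m n\<^esub> c) \<oplus>\<^bsub>U m n\<^esub> (b \<otimes>\<^bsub>U m n\<^esub> sigma m d),
        (a \<otimes>\<^bsub>U m n\<^esub> d) \<oplus>\<^bsub>U m n\<^esub> (b \<otimes>\<^bsub>U m n\<^esub> sigma m c))),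
     one = (\<one>\<^bsub>U m n\<^esub>, \<zero>\<^bsub>U m n\<^esub>), zero = (\<zero>\<^bsub>U m n\<^esub>, \<zero>\<^bsub>U m n\<^esub>),
     add = (\<lambda>(a, b) (c, d). (a \<oplus>\<^bsub>U m n\<^esub> c, b \<oplus>\<^bsub>U m n\<^esub> d))\<rparr>"

definition us_of :: "nat \<Rightarrow> nat \<Rightarrow> ugen free \<Rightarrow> ugen free set \<times> ugen free set" where
  "us_of m n a = (u_class m n a, \<zero>\<^bsub>U m n\<^esub>)"

definition us_sigma :: "nat \<Rightarrow> nat \<Rightarrow> ugen free set \<times> ugen free set" where
  "us_sigma m n = (\<zero>\<^bsub>U m n\<^esub>, \<one>\<^bsub>U m n\<^esub>)"

section \<open>The vector representation and its tensor powers\<close>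

type_synonym us_rep = "ugen free set \<times> ugen free set \<Rightarrow> vec \<Rightarrow> vec"

definition us_representation :: "nat \<Rightarrow> nat \<Rightarrow> nat \<Rightarrow> us_rep \<Rightarrow> bool" where
  "us_representation m n r \<rho> \<longleftrightarrow>
     alg_hom (U_sigma m n) (\<lambda>c. us_of m n (const c)) (End_alg (m + n) r) (scalar_op (m + n) r) \<rho>"

definition vector_rep :: "nat \<Rightarrow> nat \<Rightarrow> us_rep \<Rightarrow> bool" where
  "vector_rep m n \<rho> \<longleftrightarrow> us_representation m n 1 \<rho> \<and>
     (\<forall>j\<in>{1..m + n}. \<rho> (us_sigma m n) (basis [j]) = scale ((-1) ^ v_par m j) (basis [j])) \<and>
     (\<forall>h\<in>P_dual m n. \<forall>j\<in>{1..m + n}.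
        \<rho> (us_of m n (gen (QH h))) (basis [j]) = scale (q powi (h (eps j))) (basis [j])) \<and>
     (\<forall>j\<in>I_set m n. \<forall>k\<in>{1..m + n}.
        \<rho> (us_of m n (gen (E j))) (basis [k]) = (if k = j + 1 then basis [j] else 0)) \<and>
     (\<forall>j\<in>I_set m n. \<forall>k\<in>{1..m + n}.
        \<rho> (us_of m n (gen (F j))) (basis [k]) = (if k = j then basis [j + 1] else 0))"

definition tensor_power_rep :: "nat \<Rightarrow> nat \<Rightarrow> nat \<Rightarrow> us_rep \<Rightarrow> us_rep \<Rightarrow> bool" where
  "tensor_power_rep m n r \<rho> \<rho>r \<longleftrightarrow> us_representation m n r \<rho>r \<and>
     \<rho>r (us_sigma m n) = tensor_ops (m + n) (replicate r (\<rho> (us_sigma m n))) \<and>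
     (\<forall>h\<in>P_dual m n. \<rho>r (us_of m n (gen (QH h))) =
        tensor_ops (m + n) (replicate r (\<rho> (us_of m n (gen (QH h)))))) \<and>
     (\<forall>i\<in>I_set m n. \<rho>r (us_of m n (gen (E i))) =
        (\<Sum>k = 1..r. tensor_ops (m + n)
          (replicate (k - 1) (\<rho> (us_sigma m n [^]\<^bsub>U_sigma m n\<^esub> par m i)) @
           [\<rho> (us_of m n (gen (E i)))] @
           replicate (r - k) (\<rho> (us_of m n (gen (QH (- ell_coroot m n i)))))))) \<and>
     (\<forall>i\<in>I_set m n. \<rho>r (us_of m n (gen (F i))) =
        (\<Sum>k = 1..r. tensor_ops (m + n)
          (replicate (k - 1) (\<rho> ((us_sigma m n [^]\<^bsub>U_sigma m n\<^esub> par m i) \<otimes>\<^bsub>U_sigma m n\<^esub>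
             us_of m n (gen (QH (ell_coroot m n i))))) @
           [\<rho> (us_of m n (gen (F i)))] @
           replicate (r - k) (id_op (m + n) 1))))"

end

theory Submission
  imports Defs
begin

text \<open>Both algebras are generated by few elements, and the operators commuting with a fixed one
  form an algebra, so it suffices that each \<open>T\<^sub>i\<close> commutes with \<open>\<sigma>\<close>, \<open>q\<^sup>h\<close>, \<open>e\<^sub>i\<close> and \<open>f\<^sub>i\<close>.
  On the \<open>r\<close>-th tensor power the latter act by pure tensors or by sums of pure tensors, each with
  a single factor \<open>e\<^sub>i\<close> or \<open>f\<^sub>i\<close>. As \<open>T\<close> commutes with \<open>D \<otimes> D\<close> for every diagonal \<open>D\<close>,
  everything reduces to \<open>T\<close> commuting with the coproduct of \<open>e\<^sub>i\<close> and \<open>f\<^sub>i\<close> on \<open>V \<otimes> V\<close>, a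
  comparison of coefficients on basis tensors.\<close>

section \<open>Free and presented algebras\<close>

lemma free_alg_simps [simp]:
  "mult (free_alg G) = (*)" "one (free_alg G) = 1" "zero (free_alg G) = 0" "add (free_alg G) = (+)"
  by (simp_all add: free_alg_def)

lemma free_alg_carrier:
  "a \<in> carrier (free_alg G) \<longleftrightarrow> (\<forall>w\<in>Poly_Mapping.keys a. set (letters w) \<subseteq> G)"
  by (simp add: free_alg_def)

lemma letters_zero [simp]: "letters 0 = []"
  by (simp add: zero_fword_def)

lemma letters_plus [simp]: "letters (u + v) = letters u @ letters v"
  by (simp add: plus_fword_def)

lemma
  shows free_alg_zero: "0 \<in> carrier (free_alg G)"
    and free_alg_one: "1 \<in> carrier (free_alg G)"
    and free_alg_const: "const c \<in> carrier (free_alg G)"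
    and free_alg_gen: "g \<in> G \<Longrightarrow> gen g \<in> carrier (free_alg G)"
  by (auto simp: free_alg_carrier gen_def const_def)

lemma free_alg_add:
  "a \<in> carrier (free_alg G) \<Longrightarrow> b \<in> carrier (free_alg G) \<Longrightarrow> a + b \<in> carrier (free_alg G)"
  using keys_add[of a b] by (fastforce simp: free_alg_carrier)

lemma free_alg_uminus: "a \<in> carrier (free_alg G) \<Longrightarrow> - a \<in> carrier (free_alg G)"
  by (simp add: free_alg_carrier in_keys_iff)

lemma free_alg_diff:
  "a \<in> carrier (free_alg G) \<Longrightarrow> b \<in> carrier (free_alg G) \<Longrightarrow> a - b \<in> carrier (free_alg G)"
  using free_alg_add[of a G "- b"] free_alg_uminus by fastforce

lemma free_alg_mult:
  "a \<in> carrier (free_alg G) \<Longrightarrow> b \<in> carrier (free_alg G) \<Longrightarrow> a * b \<in> carrier (free_alg G)"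
  using keys_mult[of a b] by (fastforce simp: free_alg_carrier)

lemmas free_alg_closed = free_alg_zero free_alg_one free_alg_const free_alg_gen
  free_alg_add free_alg_diff free_alg_mult

lemma ring_free_alg: "ring (free_alg G)"
proof (intro ringI abelian_groupI monoidI)
  fix x assume "x \<in> carrier (free_alg G)"
  then show "\<exists>y\<in>carrier (free_alg G). y \<oplus>\<^bsub>free_alg G\<^esub> x = \<zero>\<^bsub>free_alg G\<^esub>"
    by (intro bexI[of _ "- x"]) (simp_all add: free_alg_uminus)
qed (simp_all add: free_alg_closed algebra_simps)

text \<open>An element is a finite sum of monomials, and a monomial is a scalar times a product of
  letters. So scalars, generators, sums and products suffice, without a case for scalar
  multiples.\<close>

lemma free_alg_induct [consumes 1, case_names const gen add mult]:
  assumes a: "a \<in> carrier (free_alg G)"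
    and const: "\<And>c. P (const c)"
    and gen: "\<And>g. g \<in> G \<Longrightarrow> P (gen g)"
    and add: "\<And>a b. a \<in> carrier (free_alg G) \<Longrightarrow> b \<in> carrier (free_alg G) \<Longrightarrow>
      P a \<Longrightarrow> P b \<Longrightarrow> P (a + b)"
    and mult: "\<And>a b. a \<in> carrier (free_alg G) \<Longrightarrow> b \<in> carrier (free_alg G) \<Longrightarrow>
      P a \<Longrightarrow> P b \<Longrightarrow> P (a * b)"
  shows "P a"
proof -
  \<comment> \<open>The coefficient is passed down to the empty word, where the monomial is
    \<open>const c\<close>.\<close>
  have word: "P (Poly_Mapping.single (Word gs) c)" if "set gs \<subseteq> G" for gs c
    using that
  proof (induction gs)
    case Nil
    then show ?case using const by (simp add: const_def)
  next
    case (Cons g gs)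
    have "P (gen g * Poly_Mapping.single (Word gs) c)"
      using Cons by (intro mult gen) (auto simp: free_alg_carrier gen_def)
    then show ?case by (simp add: gen_def mult_single plus_fword_def)
  qed
  have "P a \<and> a \<in> carrier (free_alg G)"
    if "\<forall>w\<in>Poly_Mapping.keys a. set (letters w) \<subseteq> G" for a
    using that
  proof (induction "card (Poly_Mapping.keys a)" arbitrary: a)
    case 0
    then show ?case using const[of 0] by (simp add: const_def free_alg_zero)
  next
    case (Suc n)
    then obtain w where w: "w \<in> Poly_Mapping.keys a" by (metis card.empty ex_in_conv nat.distinct(1))
    \<comment> \<open>Subtracting one monomial of \<open>a\<close> removes exactly the key
      \<open>w\<close>, so the number of keys drops by one.\<close>
    define s where "s = Poly_Mapping.single w (Poly_Mapping.lookup a w)"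
    have keys: "Poly_Mapping.keys (a - s) = Poly_Mapping.keys a - {w}"
      by (auto simp: in_keys_iff s_def lookup_minus lookup_single when_def split: if_splits)
    have "P (a - s) \<and> a - s \<in> carrier (free_alg G)"
      using Suc.hyps w Suc.prems by (intro Suc.hyps) (auto simp: keys)
    moreover have "P s"
      using word[of "letters w"] Suc.prems w by (simp add: s_def)
    moreover have "s \<in> carrier (free_alg G)"
      using Suc.prems w by (simp add: s_def free_alg_carrier)
    ultimately have "P ((a - s) + s)" by (intro add) auto
    then show ?case using Suc.prems by (simp add: free_alg_carrier)
  qed
  then show ?thesis using a by (simp add: free_alg_carrier)
qed

section \<open>The Hecke algebra as a quotient of the free algebra\<close>

lemma hecke_rels_carrier: "hecke_rels r \<subseteq> carrier (free_alg {1..<r})"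
  unfolding hecke_rels_def by (auto intro!: free_alg_closed)

lemma ideal_hecke: "ideal (Idl\<^bsub>free_alg {1..<r}\<^esub> (hecke_rels r)) (free_alg {1..<r})"
  using ring.genideal_ideal[OF ring_free_alg hecke_rels_carrier] .

lemma hecke_class_hom: "hecke_class r \<in> ring_hom (free_alg {1..<r}) (hecke r)"
  using ideal.rcos_ring_hom[OF ideal_hecke[of r]]
  unfolding hecke_def hecke_class_def[abs_def] .

lemma hecke_carrier: "carrier (hecke r) = hecke_class r ` carrier (free_alg {1..<r})"
  by (auto simp: hecke_def hecke_class_def FactRing_def A_RCOSETS_def')

section \<open>The quantum superalgebra and its extension as quotients\<close>

lemma P_dual_closed:
  shows "0 \<in> P_dual m n"
    and "h \<in> P_dual m n \<Longrightarrow> h' \<in> P_dual m n \<Longrightarrow> h + h' \<in> P_dual m n"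
    and "h \<in> P_dual m n \<Longrightarrow> - h \<in> P_dual m n"
    and ell_coroot_P_dual: "ell_coroot m n i \<in> P_dual m n"
proof -
  show "ell_coroot m n i \<in> P_dual m n"
    by (auto simp: P_dual_def ell_coroot_def coroot_def bform_def P_lattice_def ring_distribs
        sum.distrib)
qed (auto simp: P_dual_def)

text \<open>A symbol \<open>QH h\<close> is a generator only for \<open>h\<close> in
  \<open>P_dual m n\<close>, so the coweights occurring in the relations (0, sums, plus and minus
  \<open>ell_coroot\<close>) have to lie there.\<close>

lemma u_rels_carrier: "u_rels m n \<subseteq> carrier (free_alg (u_gens m n))"
  unfolding u_rels_def
  by (auto intro!: free_alg_closed simp: u_gens_def P_dual_closed)

lemma subalg_carrier:
  "S \<subseteq> carrier (free_alg G) \<Longrightarrow> a \<in> subalg S \<Longrightarrow> a \<in> carrier (free_alg G)"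
  by (rotate_tac, induction rule: subalg.induct) (auto intro: free_alg_closed)

lemma sum_ideal_carrier:
  "A \<subseteq> carrier (free_alg G) \<Longrightarrow> X \<subseteq> carrier (free_alg G) \<Longrightarrow> a \<in> sum_ideal A X \<Longrightarrow>
    a \<in> carrier (free_alg G)"
  by (rotate_tac 2, induction rule: sum_ideal.induct) (auto intro: free_alg_closed)

text \<open>The family of ideals intersected in \<^const>\<open>u_ideal\<close> contains the whole free algebra, so the
  intersection is not the junk value \<^term>\<open>UNIV\<close>.\<close>

lemma ideal_u_ideal: "ideal (u_ideal m n) (free_alg (u_gens m n))"
proof -
  let ?C = "carrier (free_alg (u_gens m n))"
  have gens: "(\<lambda>i. gen (E i)) ` I_set m n \<subseteq> ?C" "(\<lambda>i. gen (F i)) ` I_set m n \<subseteq> ?C"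
    by (auto intro!: free_alg_gen simp: u_gens_def)
  have "u_pos m n \<subseteq> ?C" "u_neg m n \<subseteq> ?C"
    using subalg_carrier gens by (auto simp: u_pos_def u_neg_def)
  \<comment> \<open>Both conditions only conclude that \<open>a\<close> lies in the ideal, which is
    automatic for the whole free algebra.\<close>
  then have "further_conditions m n ?C"
    unfolding further_conditions_def using sum_ideal_carrier gens by blast
  then show ?thesis
    unfolding u_ideal_def
    using ring.oneideal[OF ring_free_alg, of "u_gens m n"] u_rels_carrier
    by (intro ring.i_Intersect[OF ring_free_alg]) blast+
qed

lemma u_class_hom: "u_class m n \<in> ring_hom (free_alg (u_gens m n)) (U m n)"
  using ideal.rcos_ring_hom[OF ideal_u_ideal[of m n]]
  unfolding U_def u_class_def[abs_def] .

lemma U_carrier: "carrier (U m n) = u_class m n ` carrier (free_alg (u_gens m n))"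
  by (auto simp: U_def u_class_def FactRing_def A_RCOSETS_def')

lemma ring_U: "ring (U m n)"
  unfolding U_def using ideal.quotient_is_ring[OF ideal_u_ideal] .

text \<open>Multiplication in a quotient ring is defined for arbitrary sets as a union of cosets, so
  these two facts are enough to evaluate 0 times \<open>sigma m X\<close>. They hold because
  \<open>free_sigma\<close> changes coefficients only and creates no new words.\<close>

lemma sigma_subset_carrier:
  assumes "X \<in> carrier (U m n)"
  shows "sigma m X \<subseteq> carrier (free_alg (u_gens m n))" "sigma m X \<noteq> {}"
proof -
  obtain a where a: "a \<in> carrier (free_alg (u_gens m n))" and X: "X = u_class m n a"
    using assms by (auto simp: U_carrier)
  interpret ideal "u_ideal m n" "free_alg (u_gens m n)" by (rule ideal_u_ideal)
  have sub: "X \<subseteq> carrier (free_alg (u_gens m n))" and "a \<in> X"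
    unfolding X u_class_def using a a_r_coset_subset_G[OF a_subset] a_rcos_self by auto
  then show "sigma m X \<noteq> {}" by (auto simp: sigma_def)
  have "free_sigma m b \<in> carrier (free_alg (u_gens m n))"
    if "b \<in> carrier (free_alg (u_gens m n))" for b
  proof -
    have "Poly_Mapping.keys (free_sigma m b) \<subseteq> Poly_Mapping.keys b"
      unfolding free_sigma_def by (rule order.trans[OF keys_sum]) auto
    then show ?thesis using that by (auto simp: free_alg_carrier)
  qed
  then show "sigma m X \<subseteq> carrier (free_alg (u_gens m n))"
    using sub by (auto simp: sigma_def)
qed

text \<open>This makes the products in \<^const>\<open>U_sigma\<close> that we need computable without
  knowing that \<^const>\<open>sigma\<close> maps cosets to cosets.\<close>

lemma U_zero_mult_sigma:
  assumes "X \<in> carrier (U m n)"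
  shows "\<zero>\<^bsub>U m n\<^esub> \<otimes>\<^bsub>U m n\<^esub> sigma m X = \<zero>\<^bsub>U m n\<^esub>"
proof -
  interpret ideal "u_ideal m n" "free_alg (u_gens m n)" by (rule ideal_u_ideal)
  \<comment> \<open>The product is the union of the cosets of all \<open>a * b\<close>. Each
    \<open>a * b\<close> lies in the ideal, so each coset is the ideal itself, the zero of the
    quotient; both factors being nonempty, the union is not empty.\<close>
  have "u_ideal m n +>\<^bsub>free_alg (u_gens m n)\<^esub> (a * b) = u_ideal m n"
    if "a \<in> u_ideal m n" "b \<in> sigma m X" for a b
    using that sigma_subset_carrier[OF assms] I_r_closed[of a b]
    by (intro a_rcos_const) auto
  moreover have "u_ideal m n \<noteq> {}" using additive_subgroup.zero_closed[OF is_additive_subgroup] by auto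
  ultimately show ?thesis
    using sigma_subset_carrier(2)[OF assms] by (auto simp: U_def FactRing_def rcoset_mult_def)
qed

lemma us_of_carrier: "a \<in> carrier (free_alg (u_gens m n)) \<Longrightarrow> us_of m n a \<in> carrier (U_sigma m n)"
  using ring.ring_simprules(2)[OF ring_U[of m n]] by (simp add: us_of_def U_sigma_def U_carrier)

lemma us_sigma_carrier: "us_sigma m n \<in> carrier (U_sigma m n)"
  using ring.ring_simprules(2,6)[OF ring_U[of m n]] by (simp add: us_sigma_def U_sigma_def)

text \<open>In the product of (a, 0) and (b, 0) every term containing \<open>sigma\<close> has left
  factor 0 and vanishes by \<open>U_zero_mult_sigma\<close>.\<close>

lemma us_of_hom:
  assumes "a \<in> carrier (free_alg (u_gens m n))" "b \<in> carrier (free_alg (u_gens m n))"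
  shows "us_of m n (a + b) = us_of m n a \<oplus>\<^bsub>U_sigma m n\<^esub> us_of m n b"
    and "us_of m n (a * b) = us_of m n a \<otimes>\<^bsub>U_sigma m n\<^esub> us_of m n b"
proof -
  interpret U: ring "U m n" by (rule ring_U)
  have c: "u_class m n a \<in> carrier (U m n)" "u_class m n b \<in> carrier (U m n)"
    using assms by (auto simp: U_carrier)
  have "u_class m n (a + b) = u_class m n a \<oplus>\<^bsub>U m n\<^esub> u_class m n b"
    "u_class m n (a * b) = u_class m n a \<otimes>\<^bsub>U m n\<^esub> u_class m n b"
    using ring_hom_add[OF u_class_hom assms] ring_hom_mult[OF u_class_hom assms] by simp_all
  then show "us_of m n (a + b) = us_of m n a \<oplus>\<^bsub>U_sigma m n\<^esub> us_of m n b"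
    "us_of m n (a * b) = us_of m n a \<otimes>\<^bsub>U_sigma m n\<^esub> us_of m n b"
    using c by (simp_all add: us_of_def U_sigma_def U_zero_mult_sigma)
qed

lemma us_of_mult_sigma:
  assumes "a \<in> carrier (free_alg (u_gens m n))"
  shows "us_of m n a \<otimes>\<^bsub>U_sigma m n\<^esub> us_sigma m n = (\<zero>\<^bsub>U m n\<^esub>, u_class m n a)"
proof -
  interpret U: ring "U m n" by (rule ring_U)
  have c: "u_class m n a \<in> carrier (U m n)" using assms by (auto simp: U_carrier)
  then show ?thesis by (simp add: us_of_def us_sigma_def U_sigma_def U_zero_mult_sigma)
qed

lemma us_one: "\<one>\<^bsub>U_sigma m n\<^esub> = us_of m n 1"
  using ring_hom_one[OF u_class_hom[of m n]] by (simp add: us_of_def U_sigma_def)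

text \<open>The first power unfolds to the unit times \<open>us_sigma\<close>. No monoid laws have
  been established for \<open>U_sigma m n\<close>, so this product is computed by
  \<open>us_of_mult_sigma\<close>.\<close>

lemma us_sigma_pow_par:
  "us_sigma m n [^]\<^bsub>U_sigma m n\<^esub> par m i = (if i = m then us_sigma m n else \<one>\<^bsub>U_sigma m n\<^esub>)"
  using us_of_mult_sigma[OF free_alg_one, of m n] ring_hom_one[OF u_class_hom[of m n]]
  by (simp add: par_def nat_pow_def us_one us_sigma_def)

text \<open>Writing the pair with the operations of \<open>U_sigma m n\<close> gives a form to which
  a ring homomorphism can be applied.\<close>

lemma U_sigma_cases:
  assumes "x \<in> carrier (U_sigma m n)"
  obtains a b where "a \<in> carrier (free_alg (u_gens m n))" "b \<in> carrier (free_alg (u_gens m n))"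
    "x = us_of m n a \<oplus>\<^bsub>U_sigma m n\<^esub> (us_of m n b \<otimes>\<^bsub>U_sigma m n\<^esub> us_sigma m n)"
proof -
  interpret U: ring "U m n" by (rule ring_U)
  obtain a b where ab: "a \<in> carrier (free_alg (u_gens m n))" "b \<in> carrier (free_alg (u_gens m n))"
    and x: "x = (u_class m n a, u_class m n b)"
    using assms by (auto simp: U_sigma_def U_carrier)
  have c: "u_class m n a \<in> carrier (U m n)" "u_class m n b \<in> carrier (U m n)"
    using ab by (auto simp: U_carrier)
  show thesis
    using that[OF ab] c unfolding us_of_mult_sigma[OF ab(2)] x
    by (simp add: us_of_def U_sigma_def)
qed

section \<open>Operators on tensor powers\<close>

lemma finite_words: "finite (words N r)"
  using finite_lists_length_eq[of "{1..N}" r] by (simp add: words_def conj_commute)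

lemma words_take: "w \<in> words N (k + l) \<Longrightarrow> take k w \<in> words N k"
  by (auto simp: words_def dest: in_set_takeD)

lemma words_drop: "w \<in> words N (k + l) \<Longrightarrow> drop k w \<in> words N l"
  by (auto simp: words_def dest: in_set_dropD)

lemma words_append: "u \<in> words N k \<Longrightarrow> v \<in> words N l \<Longrightarrow> u @ v \<in> words N (k + l)"
  by (auto simp: words_def)

lemma words_add: "words N (k + l) = (\<lambda>(u, v). u @ v) ` (words N k \<times> words N l)"
proof -
  have "w \<in> (\<lambda>(u, v). u @ v) ` (words N k \<times> words N l)" if "w \<in> words N (k + l)" for w
    using words_take[OF that] words_drop[OF that]
    by (intro image_eqI[of _ _ "(take k w, drop k w)"]) auto
  then show ?thesis by (auto intro: words_append)
qed

lemma sum_words_add: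
  "(\<Sum>w\<in>words N (k + l). g w) = (\<Sum>u\<in>words N k. \<Sum>v\<in>words N l. g (u @ v))"
proof -
  have "inj_on (\<lambda>(u, v). u @ v) (words N k \<times> words N l)"
    by (auto simp: inj_on_def words_def)
  then show ?thesis
    unfolding words_add
    by (subst sum.reindex) (auto simp: sum.cartesian_product intro: sum.cong)
qed

lemma words_2: "words N 2 = (\<lambda>(a, b). [a, b]) ` ({1..N} \<times> {1..N})"
  by (auto simp: words_def length_Suc_conv numeral_2_eq_2)

section \<open>Tensors in coordinates and their endomorphisms\<close>

lemma sum_fun_apply: "(\<Sum>x\<in>S. f x) u = (\<Sum>x\<in>S. f x u)"
  by (induction S rule: infinite_finite_induct) auto

lemma tensor_space_closed:
  shows "0 \<in> tensor_space N r"
    and "f \<in> tensor_space N r \<Longrightarrow> g \<in> tensor_space N r \<Longrightarrow> f + g \<in> tensor_space N r"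
    and "f \<in> tensor_space N r \<Longrightarrow> scale c f \<in> tensor_space N r"
    and basis_tensor_space: "w \<in> words N r \<Longrightarrow> basis w \<in> tensor_space N r"
  by (auto simp: tensor_space_def scale_def basis_def)

lemma tensor_space_sum:
  "(\<And>x. x \<in> S \<Longrightarrow> f x \<in> tensor_space N r) \<Longrightarrow> (\<Sum>x\<in>S. f x) \<in> tensor_space N r"
  by (induction S rule: infinite_finite_induct) (auto intro: tensor_space_closed)

lemma vec_tensor_space:
  assumes "x \<in> tensor_space N k" "y \<in> tensor_space N l"
  shows "vec_tensor k x y \<in> tensor_space N (k + l)"
proof -
  have "w \<in> words N (k + l)" if "take k w \<in> words N k" "drop k w \<in> words N l" for w
    using words_append[OF that] by simp
  then show ?thesis
    using assms by (auto simp: tensor_space_def vec_tensor_def)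
qed

lemma vec_tensor_assoc:
  "vec_tensor (k + l) (vec_tensor k x y) z = vec_tensor k x (vec_tensor l y z)"
  by (auto simp: vec_tensor_def fun_eq_iff take_drop min_def add.commute mult.assoc)

lemma vec_tensor_basis:
  "length w = k \<Longrightarrow> vec_tensor k (basis w) (basis w') = basis (w @ w')"
  by (auto simp: vec_tensor_def basis_def fun_eq_iff) (metis append_take_drop_id)

lemma vec_tensor_scale:
  "vec_tensor k (scale c x) y = scale c (vec_tensor k x y)"
  "vec_tensor k x (scale c y) = scale c (vec_tensor k x y)"
  "vec_tensor k 0 y = 0" "vec_tensor k x 0 = 0"
  by (auto simp: vec_tensor_def scale_def fun_eq_iff)

lemma scale_simps [simp]:
  "scale c (x + y) = scale c x + scale c y" "scale c (scale d x) = scale (c * d) x"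
  "scale 1 x = x" "scale 0 x = 0" "scale c 0 = 0"
  by (auto simp: scale_def fun_eq_iff algebra_simps)

lemma End_alg_simps [simp]:
  "mult (End_alg N r) = (\<circ>)" "one (End_alg N r) = id_op N r"
  "zero (End_alg N r) = 0" "add (End_alg N r) = (+)"
  by (simp_all add: End_alg_def)

lemma EndI:
  assumes "\<And>f. f \<in> tensor_space N r \<Longrightarrow> A f \<in> tensor_space N r"
    and "\<And>f g. f \<in> tensor_space N r \<Longrightarrow> g \<in> tensor_space N r \<Longrightarrow> A (f + g) = A f + A g"
    and "\<And>c f. f \<in> tensor_space N r \<Longrightarrow> A (scale c f) = scale c (A f)"
    and "\<And>f. f \<notin> tensor_space N r \<Longrightarrow> A f = 0"
  shows "A \<in> carrier (End_alg N r)"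
  using assms by (simp add: End_alg_def)

lemma EndD:
  assumes "A \<in> carrier (End_alg N r)"
  shows "f \<in> tensor_space N r \<Longrightarrow> A f \<in> tensor_space N r"
    and "f \<in> tensor_space N r \<Longrightarrow> g \<in> tensor_space N r \<Longrightarrow> A (f + g) = A f + A g"
    and "f \<in> tensor_space N r \<Longrightarrow> A (scale c f) = scale c (A f)"
    and "f \<notin> tensor_space N r \<Longrightarrow> A f = 0"
    and "A 0 = 0"
proof -
  show "A 0 = 0"
    using assms tensor_space_closed(1)[of N r] scale_simps(4)[of "A 0"]
    by (simp add: End_alg_def) (metis scale_simps(4))
qed (use assms in \<open>simp_all add: End_alg_def\<close>)

lemma End_sum_apply:
  assumes "A \<in> carrier (End_alg N r)" "\<And>x. x \<in> S \<Longrightarrow> f x \<in> tensor_space N r"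
  shows "A (\<Sum>x\<in>S. f x) = (\<Sum>x\<in>S. A (f x))"
  using assms(2)
  by (induction S rule: infinite_finite_induct)
    (simp_all add: EndD[OF assms(1)] tensor_space_sum)

lemma End_comp:
  assumes A: "A \<in> carrier (End_alg N r)" and B: "B \<in> carrier (End_alg N r)"
  shows "A \<circ> B \<in> carrier (End_alg N r)"
  by (rule EndI) (simp_all only: comp_apply EndD(1-5)[OF A] EndD(1-5)[OF B] not_False_eq_True)

lemma
  shows End_add: "A \<in> carrier (End_alg N r) \<Longrightarrow> B \<in> carrier (End_alg N r) \<Longrightarrow>
      A + B \<in> carrier (End_alg N r)"
    and End_zero: "0 \<in> carrier (End_alg N r)"
    and End_scalar: "scalar_op N r c \<in> carrier (End_alg N r)"
  by (auto intro!: EndI tensor_space_closed simp: EndD scalar_op_def mult.commute algebra_simps)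

lemma End_sum:
  "(\<And>x. x \<in> S \<Longrightarrow> f x \<in> carrier (End_alg N r)) \<Longrightarrow> (\<Sum>x\<in>S. f x) \<in> carrier (End_alg N r)"
  by (induction S rule: infinite_finite_induct) (auto intro: End_add End_zero)

lemma End_comm_add:
  assumes P: "P \<in> carrier (End_alg N r)"
    and A: "A \<in> carrier (End_alg N r)" and B: "B \<in> carrier (End_alg N r)"
    and "P \<circ> A = A \<circ> P" "P \<circ> B = B \<circ> P"
  shows "P \<circ> (A + B) = (A + B) \<circ> P"
proof
  fix f
  \<comment> \<open>Operators vanish outside the tensor space, so their values lie in it for every
    \<open>f\<close>, also for \<open>f\<close> outside.\<close>
  have ts: "A f \<in> tensor_space N r" "B f \<in> tensor_space N r"
    using EndD(1,4)[OF A] EndD(1,4)[OF B] tensor_space_closed(1) by metis+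
  have "P (A f + B f) = A (P f) + B (P f)"
    using EndD(2)[OF P ts] assms(4,5) by (metis comp_apply)
  then show "(P \<circ> (A + B)) f = ((A + B) \<circ> P) f" by simp
qed

lemma End_comm_sum:
  assumes P: "P \<in> carrier (End_alg N r)"
    and "\<And>k. k \<in> S \<Longrightarrow> f k \<in> carrier (End_alg N r)"
    and "\<And>k. k \<in> S \<Longrightarrow> P \<circ> f k = f k \<circ> P"
  shows "P \<circ> (\<Sum>k\<in>S. f k) = (\<Sum>k\<in>S. f k) \<circ> P"
  using assms(2,3)
proof (induction S rule: infinite_finite_induct)
  case (insert k S)
  have "P \<circ> (f k + (\<Sum>k\<in>S. f k)) = (f k + (\<Sum>k\<in>S. f k)) \<circ> P"
    using insert.prems
    by (intro End_comm_add[OF P] End_sum insert.IH insert.prems(2)) simp_all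
  then show ?case by (simp only: sum.insert[OF insert.hyps])
qed (simp_all add: fun_eq_iff EndD(5)[OF P])

lemma tensor_space_expand:
  assumes "f \<in> tensor_space N r"
  shows "f = (\<Sum>w\<in>words N r. scale (f w) (basis w))"
  using assms
  by (auto simp: fun_eq_iff sum_fun_apply scale_def basis_def tensor_space_def
      sum.delta finite_words if_distrib[of "(*) _"] cong: if_cong)

lemma End_expand:
  assumes "A \<in> carrier (End_alg N r)" "f \<in> tensor_space N r"
  shows "A f = (\<Sum>w\<in>words N r. scale (f w) (A (basis w)))"
  by (subst tensor_space_expand[OF assms(2)])
    (simp add: End_sum_apply[OF assms(1)] EndD[OF assms(1)] tensor_space_closed)

text \<open>Off the tensor space both operators are 0, so agreement on basis tensors already gives
  equality as functions.\<close>

lemma End_eqI: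
  assumes "A \<in> carrier (End_alg N r)" "B \<in> carrier (End_alg N r)"
    and "\<And>w. w \<in> words N r \<Longrightarrow> A (basis w) = B (basis w)"
  shows "A = B"
proof
  fix f
  show "A f = B f"
  proof (cases "f \<in> tensor_space N r")
    case True
    then show ?thesis
      by (simp add: End_expand[OF assms(1)] End_expand[OF assms(2)] assms(3))
  next
    case False
    then show ?thesis using assms(1,2) by (simp add: EndD)
  qed
qed

lemma lin_ext_End:
  assumes "\<And>w. w \<in> words N r \<Longrightarrow> \<phi> w \<in> tensor_space N r"
  shows "lin_ext N r \<phi> \<in> carrier (End_alg N r)"
proof (rule EndI)
  show "lin_ext N r \<phi> (scale c f) = scale c (lin_ext N r \<phi> f)" if "f \<in> tensor_space N r" for c f
    using that
    by (simp add: lin_ext_def tensor_space_closed fun_eq_iff sum_fun_apply)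
      (simp add: scale_def sum_fun_apply sum_distrib_left mult.assoc)
  show "lin_ext N r \<phi> f \<in> tensor_space N r" if "f \<in> tensor_space N r" for f
    using that assms by (auto simp: lin_ext_def intro!: tensor_space_sum tensor_space_closed)
qed (auto simp: lin_ext_def tensor_space_closed sum.distrib[symmetric] scale_def fun_eq_iff
    sum_fun_apply ring_distribs)

lemma lin_ext_basis:
  assumes "w \<in> words N r"
  shows "lin_ext N r \<phi> (basis w) = \<phi> w"
  using assms
  by (simp add: lin_ext_def tensor_space_closed fun_eq_iff sum_fun_apply)
    (simp add: scale_def basis_def finite_words if_distrib[where f = "\<lambda>c. c * _"] cong: if_cong)

section \<open>Tensor products of operators\<close>

lemma op_tensor_End:
  assumes "A \<in> carrier (End_alg N k)" "B \<in> carrier (End_alg N l)"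
  shows "op_tensor N k A l B \<in> carrier (End_alg N (k + l))"
  unfolding op_tensor_def
  by (intro lin_ext_End vec_tensor_space EndD(1)[OF assms(1)] EndD(1)[OF assms(2)]
      basis_tensor_space words_take words_drop)

lemma op_tensor_basis:
  "w \<in> words N (k + l) \<Longrightarrow>
    op_tensor N k A l B (basis w) = vec_tensor k (A (basis (take k w))) (B (basis (drop k w)))"
  unfolding op_tensor_def by (rule lin_ext_basis)

text \<open>\<open>op_tensor\<close> is given on basis tensors only. Expanding \<open>x\<close> and
  \<open>y\<close> in the basis yields a double sum, which factors into the expansions of
  \<open>A x\<close> and \<open>B y\<close>.\<close>

lemma op_tensor_vec_tensor:
  assumes A: "A \<in> carrier (End_alg N k)" and B: "B \<in> carrier (End_alg N l)"
    and x: "x \<in> tensor_space N k" and y: "y \<in> tensor_space N l"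
  shows "op_tensor N k A l B (vec_tensor k x y) = vec_tensor k (A x) (B y)"
proof
  fix w
  have "op_tensor N k A l B (vec_tensor k x y) =
      (\<Sum>u\<in>words N k. \<Sum>v\<in>words N l.
        scale (vec_tensor k x y (u @ v)) (op_tensor N k A l B (basis (u @ v))))"
    by (subst End_expand[OF op_tensor_End[OF A B] vec_tensor_space[OF x y]]) (rule sum_words_add)
  also have "\<dots> = (\<Sum>u\<in>words N k. \<Sum>v\<in>words N l.
        scale (x u * y v) (vec_tensor k (A (basis u)) (B (basis v))))"
  proof (intro sum.cong refl)
    fix u v assume u: "u \<in> words N k" and v: "v \<in> words N l"
    then have "length u = k" by (simp add: words_def)
    then show "scale (vec_tensor k x y (u @ v)) (op_tensor N k A l B (basis (u @ v))) =
        scale (x u * y v) (vec_tensor k (A (basis u)) (B (basis v)))"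
      by (simp add: op_tensor_basis words_append u v vec_tensor_def)
  qed
  finally show "op_tensor N k A l B (vec_tensor k x y) w = vec_tensor k (A x) (B y) w"
    unfolding End_expand[OF A x] End_expand[OF B y]
    by (simp add: sum_fun_apply vec_tensor_def scale_def sum_product mult_ac)
qed

text \<open>The interchange law holds without a sign because \<open>op_tensor\<close> has no Koszul
  signs; parity enters through \<open>us_sigma\<close> and \<open>T_op\<close> instead.\<close>

lemma op_tensor_comp:
  assumes "A \<in> carrier (End_alg N k)" "B \<in> carrier (End_alg N l)"
    and "C \<in> carrier (End_alg N k)" "D \<in> carrier (End_alg N l)"
  shows "op_tensor N k A l B \<circ> op_tensor N k C l D = op_tensor N k (A \<circ> C) l (B \<circ> D)"
proof (rule End_eqI)
  fix w assume w: "w \<in> words N (k + l)"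
  have "C (basis (take k w)) \<in> tensor_space N k" "D (basis (drop k w)) \<in> tensor_space N l"
    using w by (auto intro!: EndD(1)[OF assms(3)] EndD(1)[OF assms(4)] basis_tensor_space
        words_take words_drop)
  then show "(op_tensor N k A l B \<circ> op_tensor N k C l D) (basis w) =
      op_tensor N k (A \<circ> C) l (B \<circ> D) (basis w)"
    by (simp add: op_tensor_basis w op_tensor_vec_tensor[OF assms(1,2)])
qed (intro op_tensor_End End_comp assms)+

lemma op_tensor_assoc:
  assumes "A \<in> carrier (End_alg N j)" "B \<in> carrier (End_alg N k)" "C \<in> carrier (End_alg N l)"
  shows "op_tensor N j A (k + l) (op_tensor N k B l C) =
    op_tensor N (j + k) (op_tensor N j A k B) l C"
proof (rule End_eqI)
  show "op_tensor N j A (k + l) (op_tensor N k B l C) \<in> carrier (End_alg N (j + k + l))"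
    using op_tensor_End[OF assms(1) op_tensor_End[OF assms(2,3)]] by (simp add: add.assoc)
  fix w assume w: "w \<in> words N (j + k + l)"
  then have w': "w \<in> words N (j + (k + l))" by (simp add: add.assoc)
  show "op_tensor N j A (k + l) (op_tensor N k B l C) (basis w) =
      op_tensor N (j + k) (op_tensor N j A k B) l C (basis w)"
    using words_drop[OF w'] words_take[OF w]
    by (simp only: op_tensor_basis w w')
      (simp add: vec_tensor_assoc take_drop add.commute min_def)
qed (intro op_tensor_End assms)

lemma id_op_apply: "f \<in> tensor_space N r \<Longrightarrow> id_op N r f = f"
  by (simp add: scalar_op_def)

lemma id_op_comp:
  assumes "A \<in> carrier (End_alg N r)"
  shows "id_op N r \<circ> A = A" "A \<circ> id_op N r = A"
proof -
  have "A f \<in> tensor_space N r" for f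
    using EndD(1,4)[OF assms] tensor_space_closed(1) by metis
  then show "id_op N r \<circ> A = A" "A \<circ> id_op N r = A"
    using EndD(4,5)[OF assms] by (auto simp: fun_eq_iff scalar_op_def)
qed

lemma words_0: "words N 0 = {[]}"
  by (auto simp: words_def)

text \<open>The 0-th tensor power is the ground field, spanned by the empty word. This starts the
  induction in \<open>tensor_ops_append\<close>.\<close>

lemma op_tensor_id_left:
  assumes "A \<in> carrier (End_alg N r)"
  shows "op_tensor N 0 (id_op N 0) r A = A"
proof (rule End_eqI[where N = N and r = r])
  show "op_tensor N 0 (id_op N 0) r A \<in> carrier (End_alg N r)"
    using op_tensor_End[OF End_scalar[of N 0 1] assms] by simp
  fix w assume "w \<in> words N r"
  then show "op_tensor N 0 (id_op N 0) r A (basis w) = A (basis w)"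
    using op_tensor_basis[of w N 0 r "id_op N 0" A] basis_tensor_space[of "[]" N 0]
    by (simp add: id_op_apply words_0) (simp add: vec_tensor_def basis_def)
qed (rule assms)

lemma tensor_ops_End:
  "(\<And>A. A \<in> set As \<Longrightarrow> A \<in> carrier (End_alg N 1)) \<Longrightarrow>
    tensor_ops N As \<in> carrier (End_alg N (length As))"
proof (induction As)
  case Nil
  then show ?case by (simp add: End_scalar)
next
  case (Cons A As)
  then have "op_tensor N 1 A (length As) (tensor_ops N As) \<in> carrier (End_alg N (1 + length As))"
    by (intro op_tensor_End) auto
  then show ?case by simp
qed

lemma tensor_ops_append:
  assumes "\<And>A. A \<in> set (As @ Bs) \<Longrightarrow> A \<in> carrier (End_alg N 1)"
  shows "tensor_ops N (As @ Bs) =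
    op_tensor N (length As) (tensor_ops N As) (length Bs) (tensor_ops N Bs)"
  using assms
proof (induction As)
  case Nil
  then show ?case by (simp add: op_tensor_id_left tensor_ops_End)
next
  case (Cons A As)
  then show ?case
    using op_tensor_assoc[of A N 1 "tensor_ops N As" "length As" "tensor_ops N Bs" "length Bs"]
    by (simp add: tensor_ops_End)
qed

section \<open>Commutation with an operator acting on two adjacent factors\<close>

text \<open>The bracketing is that of the operator of \<open>T_i\<close> in
  \<open>sign_q_perm_rep\<close>, with \<open>k = i - 1\<close> and \<open>l = r - i - 1\<close>, so
  the two agree literally.\<close>

definition at_pair :: "nat \<Rightarrow> nat \<Rightarrow> (vec \<Rightarrow> vec) \<Rightarrow> nat \<Rightarrow> vec \<Rightarrow> vec" where
  "at_pair N k T l =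
    op_tensor N k (id_op N k) (2 + l) (op_tensor N 2 T l (id_op N l))"

lemma at_pair_End:
  "T \<in> carrier (End_alg N 2) \<Longrightarrow> at_pair N k T l \<in> carrier (End_alg N (k + (2 + l)))"
  unfolding at_pair_def by (intro op_tensor_End End_scalar)

text \<open>This merges the two summands of a coproduct whose distinguished factor lies in the
  adjacent pair.\<close>

lemma op_tensor_add_mid:
  assumes "A \<in> carrier (End_alg N k)" "C \<in> carrier (End_alg N l)"
    and B: "B \<in> carrier (End_alg N 2)" "B' \<in> carrier (End_alg N 2)"
  shows "op_tensor N k A (2 + l) (op_tensor N 2 (B + B') l C) =
    op_tensor N k A (2 + l) (op_tensor N 2 B l C) + op_tensor N k A (2 + l) (op_tensor N 2 B' l C)"
proof (rule End_eqI)
  fix w assume w: "w \<in> words N (k + (2 + l))"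
  show "op_tensor N k A (2 + l) (op_tensor N 2 (B + B') l C) (basis w) =
    (op_tensor N k A (2 + l) (op_tensor N 2 B l C) +
      op_tensor N k A (2 + l) (op_tensor N 2 B' l C)) (basis w)"
    using words_drop[OF w]
    by (simp add: op_tensor_basis w del: add_2_eq_Suc)
      (simp add: vec_tensor_def fun_eq_iff algebra_simps)
qed (intro op_tensor_End End_add assms)+

text \<open>By the interchange law the identities are absorbed in the outer positions, and the two
  products differ only in the order of \<open>T\<close> and \<open>B\<close>.\<close>

lemma at_pair_comm:
  assumes "T \<in> carrier (End_alg N 2)" "B \<in> carrier (End_alg N 2)"
    and "A \<in> carrier (End_alg N k)" "C \<in> carrier (End_alg N l)"
    and "T \<circ> B = B \<circ> T"
  shows "at_pair N k T l \<circ> op_tensor N k A (2 + l) (op_tensor N 2 B l C) =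
    op_tensor N k A (2 + l) (op_tensor N 2 B l C) \<circ> at_pair N k T l"
  unfolding at_pair_def
  by (simp add: op_tensor_comp op_tensor_End End_scalar assms id_op_comp End_comp del: add_2_eq_Suc)

lemma tensor_ops_pair:
  assumes "\<And>A. A \<in> set (As @ [B, B'] @ Cs) \<Longrightarrow> A \<in> carrier (End_alg N 1)"
  shows "tensor_ops N (As @ [B, B'] @ Cs) = op_tensor N (length As) (tensor_ops N As)
    (2 + length Cs) (op_tensor N 2 (op_tensor N 1 B 1 B') (length Cs) (tensor_ops N Cs))"
proof -
  \<comment> \<open>\<open>tensor_ops\<close> closes every list with the identity of the 0-th power,
    which has to be removed on the right of \<open>B'\<close>.\<close>
  have B': "op_tensor N 1 B' 0 (id_op N 0) = B'"
  proof (rule End_eqI[where N = N and r = 1])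
    show "op_tensor N 1 B' 0 (id_op N 0) \<in> carrier (End_alg N 1)"
      using op_tensor_End[of B' N 1 "id_op N 0" 0] assms by (simp add: End_scalar)
    fix w assume w: "w \<in> words N 1"
    then have "op_tensor N 1 B' 0 (id_op N 0) (basis w) = vec_tensor 1 (B' (basis w)) (basis [])"
      using op_tensor_basis[of w N 1 0 B' "id_op N 0"] basis_tensor_space[of "[]" N 0]
      by (auto simp: id_op_apply words_0 words_def)
    also have "\<dots> = B' (basis w)"
    proof
      fix u
      have "B' (basis w) \<in> tensor_space N 1"
        using EndD(1)[OF _ basis_tensor_space[OF w], of B'] assms by simp
      then show "vec_tensor 1 (B' (basis w)) (basis []) u = B' (basis w) u"
        \<comment> \<open>For \<open>u\<close> of length at most 1 the part dropped is empty; for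
          longer \<open>u\<close> both sides are 0.\<close>
        by (cases "length u \<le> 1") (auto simp: vec_tensor_def basis_def tensor_space_def words_def)
    qed
    finally show "op_tensor N 1 B' 0 (id_op N 0) (basis w) = B' (basis w)" .
  qed (use assms in auto)
  have "tensor_ops N ([B, B'] @ Cs) =
      op_tensor N (length [B, B']) (tensor_ops N [B, B']) (length Cs) (tensor_ops N Cs)"
    using assms by (intro tensor_ops_append) auto
  moreover have "tensor_ops N (As @ [B, B'] @ Cs) =
      op_tensor N (length As) (tensor_ops N As) (length ([B, B'] @ Cs)) (tensor_ops N ([B, B'] @ Cs))"
    using assms by (intro tensor_ops_append) auto
  ultimately show ?thesis using B' by (simp add: numeral_2_eq_2)
qed

lemma at_pair_tensor_ops_comm:
  assumes "\<And>A. A \<in> set (As @ [B, B'] @ Cs) \<Longrightarrow> A \<in> carrier (End_alg N 1)"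
    and "T \<in> carrier (End_alg N 2)"
    and "T \<circ> op_tensor N 1 B 1 B' = op_tensor N 1 B 1 B' \<circ> T"
  shows "at_pair N (length As) T (length Cs) \<circ> tensor_ops N (As @ [B, B'] @ Cs) =
    tensor_ops N (As @ [B, B'] @ Cs) \<circ> at_pair N (length As) T (length Cs)"
proof -
  have B: "op_tensor N 1 B 1 B' \<in> carrier (End_alg N 2)"
    using op_tensor_End[of B N 1 B' 1] assms(1) by (simp add: numeral_2_eq_2)
  have eq: "tensor_ops N (As @ [B, B'] @ Cs) = op_tensor N (length As) (tensor_ops N As)
      (2 + length Cs) (op_tensor N 2 (op_tensor N 1 B 1 B') (length Cs) (tensor_ops N Cs))"
    by (intro tensor_ops_pair assms(1))
  have As: "tensor_ops N As \<in> carrier (End_alg N (length As))"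
    and Cs: "tensor_ops N Cs \<in> carrier (End_alg N (length Cs))"
    by (intro tensor_ops_End assms(1); simp)+
  show ?thesis
    unfolding eq by (rule at_pair_comm[OF assms(2) B As Cs assms(3)])
qed

text \<open>This is the case of the group-like generators, which act by the same operator on every
  factor.\<close>

lemma at_pair_replicate_comm:
  assumes "A \<in> carrier (End_alg N 1)" "T \<in> carrier (End_alg N 2)"
    and "T \<circ> op_tensor N 1 A 1 A = op_tensor N 1 A 1 A \<circ> T" "k + 2 + l = r"
  shows "at_pair N k T l \<circ> tensor_ops N (replicate r A) =
    tensor_ops N (replicate r A) \<circ> at_pair N k T l"
proof -
  have "replicate r A = replicate k A @ [A, A] @ replicate l A"
    using assms(4) by (auto simp: replicate_add numeral_2_eq_2 replicate_app_Cons_same)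
  moreover have "B \<in> carrier (End_alg N 1)"
    if "B \<in> set (replicate k A @ [A, A] @ replicate l A)" for B
    using that assms(1) by (auto split: if_splits)
  ultimately show ?thesis
    using at_pair_tensor_ops_comm[OF _ assms(2,3), of "replicate k A" "replicate l A"]
    by (simp only: length_replicate)
qed

text \<open>The iterated coproduct of a skew-primitive element with coproduct e \<otimes> t + s
  \<otimes> e; both \<open>E i\<close> and \<open>F i\<close> are of this kind.\<close>

definition coproduct_sum :: "nat \<Rightarrow> nat \<Rightarrow> (vec \<Rightarrow> vec) \<Rightarrow> (vec \<Rightarrow> vec) \<Rightarrow> (vec \<Rightarrow> vec) \<Rightarrow> vec \<Rightarrow> vec"
  where "coproduct_sum N r s e t =
    (\<Sum>k = 1..r. tensor_ops N (replicate (k - 1) s @ [e] @ replicate (r - k) t))"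

text \<open>Only the two summands with \<open>e\<close> in one of the two adjacent factors have to be
  treated together.\<close>

lemma at_pair_coproduct_sum_comm:
  assumes s: "s \<in> carrier (End_alg N 1)" and e: "e \<in> carrier (End_alg N 1)"
    and t: "t \<in> carrier (End_alg N 1)" and T: "T \<in> carrier (End_alg N 2)"
    and ss: "T \<circ> op_tensor N 1 s 1 s = op_tensor N 1 s 1 s \<circ> T"
    and tt: "T \<circ> op_tensor N 1 t 1 t = op_tensor N 1 t 1 t \<circ> T"
    and et: "T \<circ> (op_tensor N 1 e 1 t + op_tensor N 1 s 1 e) =
      (op_tensor N 1 e 1 t + op_tensor N 1 s 1 e) \<circ> T"
    and r: "a + 2 + l = r"
  shows "at_pair N a T l \<circ> coproduct_sum N r s e t = coproduct_sum N r s e t \<circ> at_pair N a T l"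
proof -
  define f where "f k = tensor_ops N (replicate (k - 1) s @ [e] @ replicate (r - k) t)" for k
  define P where "P = at_pair N a T l"
  have P: "P \<in> carrier (End_alg N r)"
    using at_pair_End[OF T, of a l] r by (simp add: P_def add.assoc)
  have f_End: "f k \<in> carrier (End_alg N r)" if "k \<in> {1..r}" for k
  proof -
    have "f k \<in> carrier (End_alg N (length (replicate (k - 1) s @ [e] @ replicate (r - k) t)))"
      unfolding f_def by (rule tensor_ops_End) (use s e t in auto)
    then show ?thesis using that by simp
  qed
  \<comment> \<open>The adjacent pair occupies positions a + 1 and a + 2. Here \<open>e\<close>
    stands to its left, so the pair carries \<open>t\<close> twice.\<close>
  have low: "P \<circ> f k = f k \<circ> P" if "1 \<le> k" "k \<le> a" for k
  proof -
    have "r - k = (a - k) + Suc (Suc l)" using that r by simp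
    then have "replicate (k - 1) s @ [e] @ replicate (r - k) t =
        (replicate (k - 1) s @ [e] @ replicate (a - k) t) @ [t, t] @ replicate l t"
      by (simp add: replicate_add replicate_app_Cons_same)
    moreover have "length (replicate (k - 1) s @ [e] @ replicate (a - k) t) = a"
      using that by simp
    ultimately show ?thesis
      using at_pair_tensor_ops_comm[of "replicate (k - 1) s @ [e] @ replicate (a - k) t" t t
          "replicate l t" N T] s e t T tt
      unfolding f_def P_def by auto
  qed
  \<comment> \<open>Now \<open>e\<close> stands to the right of the pair, which carries
    \<open>s\<close> twice.\<close>
  have high: "P \<circ> f k = f k \<circ> P" if "a + 3 \<le> k" "k \<le> r" for k
  proof -
    have "replicate (a + Suc (Suc (k - a - 3))) s = replicate a s @ [s, s] @ replicate (k - a - 3) s"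
      by (simp only: replicate_add replicate_Suc append_Cons append_Nil)
    moreover have "k - 1 = a + Suc (Suc (k - a - 3))" using that by simp
    ultimately have "replicate (k - 1) s @ [e] @ replicate (r - k) t =
        replicate a s @ [s, s] @ (replicate (k - a - 3) s @ [e] @ replicate (r - k) t)"
      by (simp only: append_assoc)
    moreover have "length (replicate (k - a - 3) s @ [e] @ replicate (r - k) t) = l"
      using that r by simp
    ultimately show ?thesis
      using at_pair_tensor_ops_comm[of "replicate a s" s s
          "replicate (k - a - 3) s @ [e] @ replicate (r - k) t" N T] s e t T ss
      unfolding f_def P_def by auto
  qed
  \<comment> \<open>These two summands agree outside the pair, so their sum carries e \<otimes> t +
    s \<otimes> e there, and \<open>et\<close> applies.\<close>
  have mid: "P \<circ> (f (a + 1) + f (a + 2)) = (f (a + 1) + f (a + 2)) \<circ> P"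
  proof -
    let ?M = "\<lambda>B. op_tensor N a (tensor_ops N (replicate a s)) (2 + l)
      (op_tensor N 2 B l (tensor_ops N (replicate l t)))"
    have B: "op_tensor N 1 e 1 t \<in> carrier (End_alg N 2)" "op_tensor N 1 s 1 e \<in> carrier (End_alg N 2)"
      using op_tensor_End[OF e t] op_tensor_End[OF s e] by (simp_all add: numeral_2_eq_2)
    have E: "tensor_ops N (replicate a s) \<in> carrier (End_alg N a)"
      "tensor_ops N (replicate l t) \<in> carrier (End_alg N l)"
      using tensor_ops_End[of "replicate a s" N] tensor_ops_End[of "replicate l t" N] s t by auto
    have "r - (a + 1) = Suc l" "r - (a + 2) = l" "a + 2 - 1 = Suc a" using r by auto
    then have "f (a + 1) = ?M (op_tensor N 1 e 1 t)" "f (a + 2) = ?M (op_tensor N 1 s 1 e)"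
      using tensor_ops_pair[of "replicate a s" e t "replicate l t" N]
        tensor_ops_pair[of "replicate a s" s e "replicate l t" N] s e t
      unfolding f_def by (auto simp: replicate_app_Cons_same split: if_splits)
    then have "f (a + 1) + f (a + 2) = ?M (op_tensor N 1 e 1 t + op_tensor N 1 s 1 e)"
      using op_tensor_add_mid[OF E B] by simp
    then show ?thesis
      unfolding P_def using at_pair_comm[OF T End_add[OF B] E et] by simp
  qed
  have split: "(\<Sum>k = 1..r. f k) =
      (f (a + 1) + f (a + 2)) + ((\<Sum>k = 1..a. f k) + (\<Sum>k = a + 3..r. f k))"
  proof -
    have "{1..r} = {a + 1, a + 2} \<union> ({1..a} \<union> {a + 3..r})" using r by auto
    then show ?thesis by (simp add: sum.union_disjoint)
  qed
  have "P \<circ> (\<Sum>k = 1..r. f k) = (\<Sum>k = 1..r. f k) \<circ> P"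
    unfolding split
  proof (rule End_comm_add[OF P _ _ mid End_comm_add[OF P]])
    show "f (a + 1) + f (a + 2) \<in> carrier (End_alg N r)"
      using r by (intro End_add f_End) auto
  qed (use r low high f_End in \<open>auto intro!: End_comm_sum[OF P] End_add End_sum\<close>)
  then show ?thesis by (simp add: P_def f_def coproduct_sum_def)
qed

section \<open>Commutants as algebras\<close>

lemma scalar_op_comm:
  assumes "A \<in> carrier (End_alg N r)"
  shows "A \<circ> scalar_op N r c = scalar_op N r c \<circ> A"
proof
  fix f
  have "A f \<in> tensor_space N r"
    using EndD(1,4)[OF assms] tensor_space_closed(1) by metis
  then show "(A \<circ> scalar_op N r c) f = (scalar_op N r c \<circ> A) f"
    using EndD(3-5)[OF assms] by (simp add: scalar_op_def)
qed

lemma comp_comm: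
  assumes "P \<circ> A = A \<circ> P" "P \<circ> B = B \<circ> P"
  shows "P \<circ> (A \<circ> B) = (A \<circ> B) \<circ> P"
  using assms by (metis comp_assoc)

text \<open>The disjunction covers both left and right representations.\<close>

lemma free_alg_commute:
  assumes X: "X \<in> carrier (End_alg N r)"
    and End: "\<And>a. a \<in> carrier (free_alg G) \<Longrightarrow> \<phi> a \<in> carrier (End_alg N r)"
    and const: "\<And>c. \<phi> (const c) = scalar_op N r c"
    and add: "\<And>a b. a \<in> carrier (free_alg G) \<Longrightarrow> b \<in> carrier (free_alg G) \<Longrightarrow>
      \<phi> (a + b) = \<phi> a + \<phi> b"
    and mult: "\<And>a b. a \<in> carrier (free_alg G) \<Longrightarrow> b \<in> carrier (free_alg G) \<Longrightarrow>
      \<phi> (a * b) = \<phi> a \<circ> \<phi> b \<or> \<phi> (a * b) = \<phi> b \<circ> \<phi> a"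
    and gen: "\<And>g. g \<in> G \<Longrightarrow> X \<circ> \<phi> (gen g) = \<phi> (gen g) \<circ> X"
    and a: "a \<in> carrier (free_alg G)"
  shows "X \<circ> \<phi> a = \<phi> a \<circ> X"
  using a
proof (induction rule: free_alg_induct)
  case (const c)
  then show ?case by (simp only: assms(3) scalar_op_comm[OF X])
next
  case (gen g)
  then show ?case by (rule assms(6))
next
  case (add a b)
  then show ?case by (simp only: assms(4)) (intro End_comm_add[OF X] End)
next
  case (mult a b)
  then show ?case using assms(5)[of a b] comp_comm[of X] by metis
qed

section \<open>The operator T and the vector representation\<close>

lemma words_pair [simp]: "[a, b] \<in> words N 2 \<longleftrightarrow> a \<in> {1..N} \<and> b \<in> {1..N}"
  by (auto simp: words_def)

lemma words_single [simp]: "[a] \<in> words N (Suc 0) \<longleftrightarrow> a \<in> {1..N}"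
  by (auto simp: words_def)

text \<open>With \<open>T_swap\<close>, the matrix of T. For a = b both basis tensors coincide; the
  eigenvalue is then stored here and \<open>T_swap\<close> is 0.\<close>

definition T_diag :: "nat \<Rightarrow> nat \<Rightarrow> nat \<Rightarrow> ratfun" where
  "T_diag m a b = (if a = b then if a \<le> m then q else - inverse q
     else if a < b then q - inverse q else 0)"

definition T_swap :: "nat \<Rightarrow> nat \<Rightarrow> nat \<Rightarrow> ratfun" where
  "T_swap m a b = (if a = b then 0 else if m < a \<and> m < b then - 1 else 1)"

lemma T_op_basis:
  assumes "a \<in> {1..m + n}" "b \<in> {1..m + n}"
  shows "T_op m n (basis [a, b]) =
    scale (T_swap m a b) (basis [b, a]) + scale (T_diag m a b) (basis [a, b])"
proof -
  \<comment> \<open>The eigenvalue formula for equal factors gives q on even and -1/q on odd basis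
    vectors.\<close>
  have "(q + inverse q + q - inverse q) / 2 = q" "(- (q + inverse q) + q - inverse q) / 2 = - inverse q"
    by (simp_all add: field_simps)
  then show ?thesis
    using assms
    by (simp add: T_op_def lin_ext_basis T_swap_def T_diag_def v_par_def)
qed

lemma T_op_End: "T_op m n \<in> carrier (End_alg (m + n) 2)"
  unfolding T_op_def
proof (rule lin_ext_End, goal_cases)
  case (1 w)
  then obtain a b where "w = [a, b]" "a \<in> {1..m + n}" "b \<in> {1..m + n}"
    by (auto simp: words_2)
  then show ?case
    by (auto simp: Let_def intro!: tensor_space_closed basis_tensor_space)
qed

lemma op_tensor_basis_pair:
  assumes "a \<in> {1..N}" "b \<in> {1..N}"
  shows "op_tensor N 1 A 1 B (basis [a, b]) = vec_tensor 1 (A (basis [a])) (B (basis [b]))"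
  using op_tensor_basis[of "[a, b]" N 1 1 A B] assms by (simp flip: numeral_2_eq_2)

lemma op_tensor_pair_End:
  "A \<in> carrier (End_alg N 1) \<Longrightarrow> B \<in> carrier (End_alg N 1) \<Longrightarrow>
    op_tensor N 1 A 1 B \<in> carrier (End_alg N 2)"
  using op_tensor_End[of A N 1 B 1] by (simp add: numeral_2_eq_2)

lemma End_pair_eqI:
  assumes "A \<in> carrier (End_alg N 2)" "B \<in> carrier (End_alg N 2)"
    and "\<And>a b. a \<in> {1..N} \<Longrightarrow> b \<in> {1..N} \<Longrightarrow> A (basis [a, b]) = B (basis [a, b])"
  shows "A = B"
  using assms(1,2) by (rule End_eqI) (use assms(3) in \<open>auto simp: words_2\<close>)

definition diagonal :: "nat \<Rightarrow> (nat \<Rightarrow> ratfun) \<Rightarrow> (vec \<Rightarrow> vec) \<Rightarrow> bool" where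
  "diagonal N d A \<longleftrightarrow> A \<in> carrier (End_alg N 1) \<and>
     (\<forall>a\<in>{1..N}. A (basis [a]) = scale (d a) (basis [a]))"

text \<open>T maps a basis tensor into the span of itself and its flip, and both have the same
  eigenvalue \<open>d a * d b\<close>.\<close>

lemma T_op_diagonal_comm:
  assumes "diagonal (m + n) d A"
  shows "T_op m n \<circ> op_tensor (m + n) 1 A 1 A = op_tensor (m + n) 1 A 1 A \<circ> T_op m n"
proof -
  let ?D = "op_tensor (m + n) 1 A 1 A"
  have A: "A \<in> carrier (End_alg (m + n) 1)"
    and d: "\<And>a. a \<in> {1..m + n} \<Longrightarrow> A (basis [a]) = scale (d a) (basis [a])"
    using assms by (auto simp: diagonal_def)
  have D: "?D (basis [a, b]) = scale (d a * d b) (basis [a, b])"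
    if "a \<in> {1..m + n}" "b \<in> {1..m + n}" for a b
    using that by (simp only: op_tensor_basis_pair d vec_tensor_scale) (simp add: vec_tensor_basis mult.commute)
  show ?thesis
    by (rule End_pair_eqI[where N = "m + n"])
      (simp_all del: One_nat_def add: D T_op_basis EndD[OF T_op_End] EndD[OF op_tensor_pair_End[OF A A]]
        op_tensor_pair_End A T_op_End End_comp tensor_space_closed mult.commute)
qed

text \<open>\<open>e\<close> is a matrix unit sending \<open>v\<^sub>j\<close> to \<open>v\<^sub>j\<^sub>'\<close>; the equations compare the coefficients
  of the two sides on the basis tensors with a factor \<open>v\<^sub>j\<close>.\<close>

lemma T_op_shift_comm:
  fixes j j' :: nat
  assumes s: "diagonal (m + n) s S" and t: "diagonal (m + n) t K"
    and e: "e \<in> carrier (End_alg (m + n) 1)"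
    and eb: "\<And>k. k \<in> {1..m + n} \<Longrightarrow> e (basis [k]) = (if k = j then basis [j'] else 0)"
    and j: "j \<in> {1..m + n}" "j' \<in> {1..m + n}" "j \<noteq> j'"
    and other: "\<And>b. b \<noteq> j \<Longrightarrow> b \<noteq> j' \<Longrightarrow>
      t b * T_swap m j' b = T_swap m j b * s b \<and> t b * T_diag m j' b = T_diag m j b * t b \<and>
      s b * T_swap m b j' = T_swap m b j * t b \<and> s b * T_diag m b j' = T_diag m b j * s b"
    and jj': "t j' * T_diag m j' j' = T_swap m j j' * s j' + T_diag m j j' * t j'"
    and j'j: "s j' * T_diag m j' j' = T_swap m j' j * t j' + T_diag m j' j * s j'"
    and jj: "t j * T_swap m j' j + s j * T_diag m j j' = T_diag m j j * s j"
      "t j * T_diag m j' j + s j * T_swap m j j' = T_diag m j j * t j"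
  shows "T_op m n \<circ> (op_tensor (m + n) 1 e 1 K + op_tensor (m + n) 1 S 1 e) =
    (op_tensor (m + n) 1 e 1 K + op_tensor (m + n) 1 S 1 e) \<circ> T_op m n"
proof -
  let ?X = "op_tensor (m + n) 1 e 1 K + op_tensor (m + n) 1 S 1 e"
  have S: "S \<in> carrier (End_alg (m + n) 1)"
    "\<And>a. a \<in> {1..m + n} \<Longrightarrow> S (basis [a]) = scale (s a) (basis [a])"
    and K: "K \<in> carrier (End_alg (m + n) 1)"
    "\<And>a. a \<in> {1..m + n} \<Longrightarrow> K (basis [a]) = scale (t a) (basis [a])"
    using s t by (auto simp: diagonal_def)
  have X: "?X (basis [a, b]) = (if a = j then scale (t b) (basis [j', b]) else 0) +
      (if b = j then scale (s a) (basis [a, j']) else 0)"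
    if "a \<in> {1..m + n}" "b \<in> {1..m + n}" for a b
    using that
    by (simp only: plus_fun_apply op_tensor_basis_pair S K eb vec_tensor_scale split: if_split)
      (simp add: vec_tensor_basis vec_tensor_scale)
  have X_End: "?X \<in> carrier (End_alg (m + n) 2)"
    by (intro End_add op_tensor_pair_End S K e)
  show ?thesis
  proof (rule End_pair_eqI)
    fix a b assume ab: "a \<in> {1..m + n}" "b \<in> {1..m + n}"
    have TX: "T_op m n (?X (basis [a, b])) =
      (if a = j then scale (t b * T_swap m j' b) (basis [b, j']) +
        scale (t b * T_diag m j' b) (basis [j', b]) else 0) +
      (if b = j then scale (s a * T_swap m a j') (basis [j', a]) +
        scale (s a * T_diag m a j') (basis [a, j']) else 0)"
      unfolding X[OF ab] using ab j(1,2)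
      by (simp add: T_op_basis EndD[OF T_op_End] tensor_space_closed)
    have XT: "?X (T_op m n (basis [a, b])) =
      scale (T_swap m a b) (?X (basis [b, a])) + scale (T_diag m a b) (?X (basis [a, b]))"
      unfolding T_op_basis[OF ab]
      by (simp only: EndD[OF X_End] tensor_space_closed words_pair ab)
    have lin: "scale c v + scale d v = scale (c + d) v" for c d v
      by (simp add: scale_def fun_eq_iff algebra_simps)
    have swap: "T_swap m k k = 0" for k by (simp add: T_swap_def)
    \<comment> \<open>Without a factor \<open>v_j\<close> both sides are 0. Paired with
      \<open>v_j'\<close>, all terms are multiples of one tensor, giving one equation each; two
      factors \<open>v_j\<close> give the two equations \<open>jj\<close>; a third index is covered
      by \<open>other\<close>.\<close>
    consider "a \<noteq> j" "b \<noteq> j" | "a = j" "b = j'" | "a = j'" "b = j" | "a = j" "b = j"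
      | "a = j" "b \<noteq> j" "b \<noteq> j'" | "b = j" "a \<noteq> j" "a \<noteq> j'"
      by blast
    then have "T_op m n (?X (basis [a, b])) = ?X (T_op m n (basis [a, b]))"
    proof cases
      case 1
      then show ?thesis
        unfolding TX XT unfolding X[OF ab] X[OF ab(2,1)] by simp
    next
      case 2
      then show ?thesis
        using jj' j unfolding TX XT unfolding X[OF ab] X[OF ab(2,1)]
        by (simp add: lin swap)
    next
      case 3
      then show ?thesis
        using j'j j unfolding TX XT unfolding X[OF ab] X[OF ab(2,1)]
        by (simp add: lin swap)
    next
      case 4
      then show ?thesis
        using swap[of j] jj[symmetric] unfolding TX XT unfolding X[OF ab] X[OF ab(2,1)]
        by (simp add: fun_eq_iff) (simp add: scale_def algebra_simps)
    next
      case 5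
      then show ?thesis
        unfolding TX XT unfolding X[OF ab] X[OF ab(2,1)] by (simp add: other)
    next
      case 6
      then show ?thesis
        unfolding TX XT unfolding X[OF ab] X[OF ab(2,1)] by (simp add: other)
    qed
    then show "(T_op m n \<circ> ?X) (basis [a, b]) = (?X \<circ> T_op m n) (basis [a, b])" by simp
  qed (intro End_comp T_op_End X_End)+
qed

section \<open>The generators in the vector representation\<close>

lemma q_nonzero: "q \<noteq> 0"
  by (simp add: q_def Zero_fract_def eq_fract)

lemma eps_P_lattice: "b \<in> {1..m + n} \<Longrightarrow> eps b \<in> P_lattice m n"
  by (auto simp: eps_def P_lattice_def)

text \<open>The two signs \<open>ell\<close> cancel, leaving the value of the bilinear form on
  \<open>root i\<close> and \<open>eps b\<close>.\<close>

lemma ell_coroot_eps: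
  assumes "b \<in> {1..m + n}"
  shows "ell_coroot m n i (eps b) =
    (if b \<le> m then 1 else - 1) * (if b = i then 1 else if b = i + 1 then - 1 else 0)"
proof -
  have "ell_coroot m n i (eps b) = bform m n (root i) (eps b)"
    using assms by (simp add: ell_coroot_def coroot_def eps_P_lattice ell_def)
  also have "\<dots> = (\<Sum>c = 1..m + n. if c = b then (if b \<le> m then 1 else - 1) * root i b else 0)"
    unfolding bform_def by (intro sum.cong) (auto simp: eps_def)
  also have "\<dots> = (if b \<le> m then 1 else - 1) * root i b"
    using assms by simp
  finally show ?thesis by (simp add: root_def eps_def)
qed

context
  fixes m n :: nat and \<rho> :: us_rep
  assumes \<rho>: "vector_rep m n \<rho>"
begin

lemma \<rho>_hom: "\<rho> \<in> ring_hom (U_sigma m n) (End_alg (m + n) 1)"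
  using \<rho> by (simp add: vector_rep_def us_representation_def alg_hom_def)

lemma \<rho>_sigma_pow:
  "diagonal (m + n) (\<lambda>a. if i = m \<and> m < a then - 1 else 1)
    (\<rho> (us_sigma m n [^]\<^bsub>U_sigma m n\<^esub> par m i))"
proof (cases "i = m")
  case True
  then show ?thesis
    using \<rho> ring_hom_closed[OF \<rho>_hom us_sigma_carrier]
    by (auto simp: diagonal_def us_sigma_pow_par vector_rep_def v_par_def)
next
  case False
  have "\<rho> \<one>\<^bsub>U_sigma m n\<^esub> = id_op (m + n) 1"
    using ring_hom_one[OF \<rho>_hom] by simp
  then show ?thesis
    using False End_scalar[of "m + n" 1 1] id_op_apply[OF basis_tensor_space, of _ "m + n" 1]
    by (auto simp: diagonal_def us_sigma_pow_par)
qed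

lemma \<rho>_QH:
  "h \<in> P_dual m n \<Longrightarrow> diagonal (m + n) (\<lambda>a. q powi (h (eps a))) (\<rho> (us_of m n (gen (QH h))))"
  using \<rho> ring_hom_closed[OF \<rho>_hom us_of_carrier[OF free_alg_gen, of "QH h"]]
  by (auto simp: diagonal_def vector_rep_def u_gens_def)

lemma diagonal_comp:
  assumes "diagonal N d A" "diagonal N d' B"
  shows "diagonal N (\<lambda>a. d a * d' a) (A \<circ> B)"
proof -
  have A: "A \<in> carrier (End_alg N 1)" and B: "B \<in> carrier (End_alg N 1)"
    using assms by (simp_all add: diagonal_def)
  show ?thesis
    using assms End_comp[OF A B] EndD(3)[OF A basis_tensor_space, of "[_]"]
    by (auto simp: diagonal_def mult.commute)
qed

text \<open>The matrix unit goes from \<open>v_(i+1)\<close> to \<open>v_i\<close>. At the odd node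
  i = m the sign of \<sigma> compensates both the eigenvalue -1/q of T at \<open>v_(m+1)\<close> and
  the differing signs of \<open>T_swap\<close> at \<open>v_m\<close> and
  \<open>v_(m+1)\<close>.\<close>

lemma T_op_E_comm:
  assumes i: "i \<in> I_set m n"
  defines "S \<equiv> \<rho> (us_sigma m n [^]\<^bsub>U_sigma m n\<^esub> par m i)"
    and "e \<equiv> \<rho> (us_of m n (gen (E i)))"
    and "K \<equiv> \<rho> (us_of m n (gen (QH (- ell_coroot m n i))))"
  shows "T_op m n \<circ> (op_tensor (m + n) 1 e 1 K + op_tensor (m + n) 1 S 1 e) =
    (op_tensor (m + n) 1 e 1 K + op_tensor (m + n) 1 S 1 e) \<circ> T_op m n"
proof (rule T_op_shift_comm)
  \<comment> \<open>The eigenvalues of \<open>K\<close>, with the integer powers of q reduced to q,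
    its inverse and 1, so that the coefficient equations become field identities.\<close>
  let ?t = "\<lambda>b. if b = i then if i \<le> m then inverse q else q
    else if b = i + 1 then if i + 1 \<le> m then q else inverse q else 1"
  show "diagonal (m + n) (\<lambda>a. if i = m \<and> m < a then - 1 else 1) S"
    unfolding S_def by (rule \<rho>_sigma_pow)
  have "q powi ((- ell_coroot m n i) (eps b)) = ?t b" if "b \<in> {1..m + n}" for b
    using that by (simp add: ell_coroot_eps power_int_minus)
  then show "diagonal (m + n) ?t K"
    using \<rho>_QH[OF P_dual_closed(3)[OF ell_coroot_P_dual], of i]
    unfolding K_def diagonal_def by simp
  show "e \<in> carrier (End_alg (m + n) 1)"
    unfolding e_def using i
    by (intro ring_hom_closed[OF \<rho>_hom] us_of_carrier free_alg_gen) (auto simp: u_gens_def)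
  show "e (basis [k]) = (if k = i + 1 then basis [i] else 0)" if "k \<in> {1..m + n}" for k
    using \<rho> i that unfolding e_def vector_rep_def by blast
qed (use i q_nonzero in \<open>auto simp: I_set_def T_swap_def T_diag_def field_simps\<close>)

text \<open>The matrix unit goes from \<open>v_i\<close> to \<open>v_(i+1)\<close>, and the Cartan
  factor now sits on the left together with the parity. The diagonal form of \<open>S\<close> is
  stated separately because T must also commute with S \<otimes> S.\<close>

lemma T_op_F_comm:
  assumes i: "i \<in> I_set m n"
  defines "S \<equiv> \<rho> ((us_sigma m n [^]\<^bsub>U_sigma m n\<^esub> par m i) \<otimes>\<^bsub>U_sigma m n\<^esub>
      us_of m n (gen (QH (ell_coroot m n i))))"
    and "e \<equiv> \<rho> (us_of m n (gen (F i)))"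
    and "K \<equiv> id_op (m + n) 1"
  shows "diagonal (m + n) (\<lambda>a. (if i = m \<and> m < a then - 1 else 1) *
      q powi (ell_coroot m n i (eps a))) S" (is ?diag)
    and "T_op m n \<circ> (op_tensor (m + n) 1 e 1 K + op_tensor (m + n) 1 S 1 e) =
      (op_tensor (m + n) 1 e 1 K + op_tensor (m + n) 1 S 1 e) \<circ> T_op m n"
proof -
  have "us_sigma m n [^]\<^bsub>U_sigma m n\<^esub> par m i \<in> carrier (U_sigma m n)"
    using us_sigma_carrier us_of_carrier[OF free_alg_one]
    by (auto simp: us_sigma_pow_par us_one)
  moreover have "us_of m n (gen (QH (ell_coroot m n i))) \<in> carrier (U_sigma m n)"
    by (intro us_of_carrier free_alg_gen) (auto simp: u_gens_def ell_coroot_P_dual)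
  ultimately have "S = \<rho> (us_sigma m n [^]\<^bsub>U_sigma m n\<^esub> par m i) \<circ>
      \<rho> (us_of m n (gen (QH (ell_coroot m n i))))"
    unfolding S_def using ring_hom_mult[OF \<rho>_hom] by simp
  then show diag: ?diag
    using diagonal_comp[OF \<rho>_sigma_pow \<rho>_QH[OF ell_coroot_P_dual]] by simp
  let ?s = "\<lambda>b. (if i = m \<and> m < b then - 1 else 1) *
    (if b = i then if i \<le> m then q else inverse q
    else if b = i + 1 then if i + 1 \<le> m then inverse q else q else 1)"
  show "T_op m n \<circ> (op_tensor (m + n) 1 e 1 K + op_tensor (m + n) 1 S 1 e) =
      (op_tensor (m + n) 1 e 1 K + op_tensor (m + n) 1 S 1 e) \<circ> T_op m n"
  proof (rule T_op_shift_comm)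
    have "q powi (ell_coroot m n i (eps b)) = (if b = i then if i \<le> m then q else inverse q
        else if b = i + 1 then if i + 1 \<le> m then inverse q else q else 1)"
      if "b \<in> {1..m + n}" for b
      using that by (simp add: ell_coroot_eps power_int_minus)
    then show "diagonal (m + n) ?s S"
      using diag unfolding diagonal_def by simp
    show "diagonal (m + n) (\<lambda>b. 1) K"
      using End_scalar id_op_apply[OF basis_tensor_space, of _ "m + n" 1]
      by (auto simp: diagonal_def K_def)
    show "e \<in> carrier (End_alg (m + n) 1)"
      unfolding e_def using i
      by (intro ring_hom_closed[OF \<rho>_hom] us_of_carrier free_alg_gen) (auto simp: u_gens_def)
    show "e (basis [k]) = (if k = i then basis [i + 1] else 0)" if "k \<in> {1..m + n}" for k
      using \<rho> i that unfolding e_def vector_rep_def by blast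
  qed (use i q_nonzero in \<open>auto simp: I_set_def T_swap_def T_diag_def field_simps\<close>)
qed

section \<open>The action on the tensor power\<close>

context
  fixes r :: nat and \<rho>r :: us_rep
  assumes \<rho>r: "tensor_power_rep m n r \<rho> \<rho>r"
begin

lemma \<rho>r_hom: "\<rho>r \<in> ring_hom (U_sigma m n) (End_alg (m + n) r)"
  using \<rho>r by (simp add: tensor_power_rep_def us_representation_def alg_hom_def)

text \<open>\<open>QH h\<close> is group-like, while \<open>E i\<close> and \<open>F i\<close> are
  skew-primitive; each type has its own commutation lemma above.\<close>

lemma at_pair_\<rho>r_gen_comm:
  assumes "a + 2 + l = r" and g: "g \<in> u_gens m n"
  shows "at_pair (m + n) a (T_op m n) l \<circ> \<rho>r (us_of m n (gen g)) =
    \<rho>r (us_of m n (gen g)) \<circ> at_pair (m + n) a (T_op m n) l"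
proof -
  have gen_End: "\<rho> (us_of m n (gen g)) \<in> carrier (End_alg (m + n) 1)"
    using g by (intro ring_hom_closed[OF \<rho>_hom] us_of_carrier free_alg_gen)
  have diag_comm: "T_op m n \<circ> op_tensor (m + n) 1 A 1 A = op_tensor (m + n) 1 A 1 A \<circ> T_op m n"
    "A \<in> carrier (End_alg (m + n) 1)" if "diagonal (m + n) d A" for d A
    using T_op_diagonal_comm[OF that] that by (simp_all add: diagonal_def)
  have id_diag: "diagonal (m + n) (\<lambda>b. 1) (id_op (m + n) 1)"
    using End_scalar id_op_apply[OF basis_tensor_space, of _ "m + n" 1]
    by (auto simp: diagonal_def)
  consider h where "g = QH h" "h \<in> P_dual m n" | i where "g = E i" "i \<in> I_set m n"
    | i where "g = F i" "i \<in> I_set m n"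
    using g by (auto simp: u_gens_def)
  then show ?thesis
  proof cases
    case (1 h)
    then have "\<rho>r (us_of m n (gen g)) =
        tensor_ops (m + n) (replicate r (\<rho> (us_of m n (gen (QH h)))))"
      using \<rho>r by (simp add: tensor_power_rep_def)
    then show ?thesis
      using at_pair_replicate_comm[OF diag_comm(2) T_op_End diag_comm(1) assms(1)] \<rho>_QH[OF 1(2)]
      by simp
  next
    case (2 i)
    then have "\<rho>r (us_of m n (gen g)) = coproduct_sum (m + n) r
        (\<rho> (us_sigma m n [^]\<^bsub>U_sigma m n\<^esub> par m i)) (\<rho> (us_of m n (gen g)))
        (\<rho> (us_of m n (gen (QH (- ell_coroot m n i)))))"
      using \<rho>r unfolding tensor_power_rep_def coproduct_sum_def by blast
    then show ?thesis
      using at_pair_coproduct_sum_comm[OF diag_comm(2)[OF \<rho>_sigma_pow] gen_End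
          diag_comm(2)[OF \<rho>_QH] T_op_End diag_comm(1)[OF \<rho>_sigma_pow]
          diag_comm(1)[OF \<rho>_QH] _ assms(1)] T_op_E_comm[OF 2(2)]
        P_dual_closed(3)[OF ell_coroot_P_dual] 2(1) by simp
  next
    case (3 i)
    then have "\<rho>r (us_of m n (gen g)) = coproduct_sum (m + n) r
        (\<rho> ((us_sigma m n [^]\<^bsub>U_sigma m n\<^esub> par m i) \<otimes>\<^bsub>U_sigma m n\<^esub>
          us_of m n (gen (QH (ell_coroot m n i))))) (\<rho> (us_of m n (gen g))) (id_op (m + n) 1)"
      using \<rho>r unfolding tensor_power_rep_def coproduct_sum_def by blast
    then show ?thesis
      using at_pair_coproduct_sum_comm[OF diag_comm(2)[OF T_op_F_comm(1)[OF 3(2)]] gen_End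
          diag_comm(2)[OF id_diag] T_op_End diag_comm(1)[OF T_op_F_comm(1)[OF 3(2)]]
          diag_comm(1)[OF id_diag] _ assms(1)] T_op_F_comm(2)[OF 3(2)] 3(1) by simp
  qed
qed

text \<open>The free algebra covers the image of \<open>us_of\<close> only. The element \<sigma> is
  treated separately, and \<open>U_sigma_cases\<close> combines the two.\<close>

lemma at_pair_\<rho>r_comm:
  assumes al: "a + 2 + l = r" and x: "x \<in> carrier (U_sigma m n)"
  shows "at_pair (m + n) a (T_op m n) l \<circ> \<rho>r x = \<rho>r x \<circ> at_pair (m + n) a (T_op m n) l"
proof -
  let ?P = "at_pair (m + n) a (T_op m n) l"
  have P: "?P \<in> carrier (End_alg (m + n) r)"
    using at_pair_End[OF T_op_End, where k = a and l = l] al by (simp add: add.assoc)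
  have us: "?P \<circ> \<rho>r (us_of m n b) = \<rho>r (us_of m n b) \<circ> ?P"
    if "b \<in> carrier (free_alg (u_gens m n))" for b
  proof (rule free_alg_commute[OF P _ _ _ _ _ that, where \<phi> = "\<lambda>b. \<rho>r (us_of m n b)"])
    show "\<rho>r (us_of m n (const c)) = scalar_op (m + n) r c" for c
      using \<rho>r by (simp add: tensor_power_rep_def us_representation_def alg_hom_def)
  qed (simp_all add: us_of_carrier us_of_hom ring_hom_closed[OF \<rho>r_hom] ring_hom_add[OF \<rho>r_hom]
      ring_hom_mult[OF \<rho>r_hom] at_pair_\<rho>r_gen_comm[OF al])
  \<comment> \<open>At i = m the exponent \<open>par m i\<close> is 1, so the power of \<sigma> is
    \<sigma> itself.\<close>
  have \<sigma>: "diagonal (m + n) (\<lambda>a. if m < a then - 1 else 1) (\<rho> (us_sigma m n))"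
    using \<rho>_sigma_pow[of m] by (simp add: us_sigma_pow_par)
  then have "?P \<circ> \<rho>r (us_sigma m n) = \<rho>r (us_sigma m n) \<circ> ?P"
    using at_pair_replicate_comm[OF _ T_op_End T_op_diagonal_comm[OF \<sigma>] al] \<sigma> \<rho>r
    by (simp add: tensor_power_rep_def diagonal_def)
  moreover obtain b c where bc: "b \<in> carrier (free_alg (u_gens m n))"
    "c \<in> carrier (free_alg (u_gens m n))"
    "x = us_of m n b \<oplus>\<^bsub>U_sigma m n\<^esub> (us_of m n c \<otimes>\<^bsub>U_sigma m n\<^esub> us_sigma m n)"
    using U_sigma_cases[OF x] .
  moreover have "us_of m n c \<otimes>\<^bsub>U_sigma m n\<^esub> us_sigma m n \<in> carrier (U_sigma m n)"
    unfolding us_of_mult_sigma[OF bc(2)] using bc(2) ring.ring_simprules(2)[OF ring_U[of m n]]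
    by (simp add: U_sigma_def U_carrier)
  ultimately show ?thesis
    using us us_of_carrier us_sigma_carrier
    by (simp add: ring_hom_add[OF \<rho>r_hom] ring_hom_mult[OF \<rho>r_hom])
      (intro End_comm_add[OF P] comp_comm End_comp ring_hom_closed[OF \<rho>r_hom]; simp)
qed

end

end

theorem proposition4p2:
  fixes m n r :: nat
    and \<pi> :: "nat free set \<Rightarrow> vec \<Rightarrow> vec"
    and \<rho> \<rho>r :: us_rep
  assumes "m + n \<ge> 1" and "r \<ge> 1"
    and "sign_q_perm_rep m n r \<pi>"
    and "vector_rep m n \<rho>"
    and "tensor_power_rep m n r \<rho> \<rho>r"
  shows "\<forall>g\<in>carrier (hecke r). \<forall>x\<in>carrier (U_sigma m n). \<pi> g \<circ> \<rho>r x = \<rho>r x \<circ> \<pi> g"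
proof (intro ballI)
  fix g x assume g: "g \<in> carrier (hecke r)" and x: "x \<in> carrier (U_sigma m n)"
  have \<pi>: "\<pi> \<in> ring_hom (hecke r) (opposite (End_alg (m + n) r))"
    and \<pi>_const: "\<And>c. \<pi> (hecke_class r (const c)) = scalar_op (m + n) r c"
    and \<pi>_gen: "\<And>i. i \<in> {1..<r} \<Longrightarrow> \<pi> (hecke_class r (gen i)) =
      at_pair (m + n) (i - 1) (T_op m n) (r - i - 1)"
    using assms(3) unfolding sign_q_perm_rep_def alg_hom_def at_pair_def by auto
  have X: "\<rho>r x \<in> carrier (End_alg (m + n) r)"
    using ring_hom_closed[OF \<rho>r_hom[OF assms(4,5)] x] .
  obtain a where a: "a \<in> carrier (free_alg {1..<r})" and g: "g = hecke_class r a"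
    using g by (auto simp: hecke_carrier)
  have closed: "hecke_class r b \<in> carrier (hecke r)" if "b \<in> carrier (free_alg {1..<r})" for b
    using that by (simp add: hecke_carrier)
  \<comment> \<open>With \<open>x\<close> fixed, the induction now runs over the Hecke
    algebra.\<close>
  have "\<rho>r x \<circ> \<pi> (hecke_class r a) = \<pi> (hecke_class r a) \<circ> \<rho>r x"
  proof (rule free_alg_commute[where \<phi> = "\<lambda>b. \<pi> (hecke_class r b)", OF X _ \<pi>_const _ _ _ a])
    fix b c assume b: "b \<in> carrier (free_alg {1..<r})" and c: "c \<in> carrier (free_alg {1..<r})"
    show "\<pi> (hecke_class r b) \<in> carrier (End_alg (m + n) r)"
      using ring_hom_closed[OF \<pi> closed[OF b]] by (simp add: opposite_def)
    show "\<pi> (hecke_class r (b + c)) = \<pi> (hecke_class r b) + \<pi> (hecke_class r c)"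
      using ring_hom_add[OF hecke_class_hom b c] ring_hom_add[OF \<pi> closed[OF b] closed[OF c]]
      by (simp add: opposite_def)
    \<comment> \<open>The second alternative holds, since the product of the opposite algebra
      reverses composition.\<close>
    show "\<pi> (hecke_class r (b * c)) = \<pi> (hecke_class r b) \<circ> \<pi> (hecke_class r c) \<or>
        \<pi> (hecke_class r (b * c)) = \<pi> (hecke_class r c) \<circ> \<pi> (hecke_class r b)"
      using ring_hom_mult[OF hecke_class_hom b c] ring_hom_mult[OF \<pi> closed[OF b] closed[OF c]]
      by (simp add: opposite_def)
  next
    fix i assume i: "i \<in> {1..<r}"
    \<comment> \<open>The truncated subtractions are exact because 1 \<le> i < r.\<close>
    then have "(i - 1) + 2 + (r - i - 1) = r" by auto
    from at_pair_\<rho>r_comm[OF assms(4,5) this x]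
    show "\<rho>r x \<circ> \<pi> (hecke_class r (gen i)) = \<pi> (hecke_class r (gen i)) \<circ> \<rho>r x"
      unfolding \<pi>_gen[OF i] by (rule sym)
  qed
  then show "\<pi> g \<circ> \<rho>r x = \<rho>r x \<circ> \<pi> g" by (simp add: g)
qed

end
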